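(* Let $M$ be an abelian group and let $T\colon M\to M$ be an automorphism of $M$ such that $1-T\colon M\to M$ is invertible. Let $A(M,T)$ be the associated Alexander quandle, $\operatorname{Adj}(A(M,T))$ its adjoint group, and $F(M,T)$ the group with underlying set $\mathbf{Z}\times M\times S(M,T)$ and multiplication $$(k,x,\alpha)(m,y,\beta)=(k+m,\;T^m x+y,\;\alpha+\beta+[T^m x\otimes y]),$$ where $S(M,T)=\operatorname{coker}(1-\tau)$ for $\tau\colon M\otimes M\to M\otimes M$, $\tau(x\otimes y)=Ty\otimes x$. Then the groups $\operatorname{Adj}(A(M,T))$ and $F(M,T)$ are isomorphic.
   Context: The Alexander quandle $A(M,T)$ of an abelian group $M$ with an automorphism $T$ is the set $M$ with the quandle operation $y*x=Ty+x-Tx$. The adjoint group $\operatorname{Adj}(Q)$ of a quandle $Q$ is the abstract group with one generator $e_x$ for each $x\in Q$ and one relation $e_{y*x}=e_x^{-1}e_ye_x$ for each pair $x,y\in Q$. Tensor products are over $\mathbf{Z}$. The additive map $\tau\colon M\otimes M\to M\otimes M$ is determined by $\tau(x\otimes y)=Ty\otimes x$, the abelian group $S(M,T)$ is the cokernel of $1-\tau$, i.e. $(M\otimes M)/\operatorname{im}(1-\tau)$, and $[x\otimes y]$ denotes the class of $x\otimes y$ in $S(M,T)$. *)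

theory Defs
  imports "HOL-Algebra.Bij" "HOL-Algebra.Generated_Groups" "HOL-Algebra.Free_Abelian_Groups"
begin

section \<open>Groups given by generators and relations\<close>

datatype 'a letter = Gen 'a | Gen_inv 'a

type_synonym 'a word = "'a letter list"

definition words :: "'a set \<Rightarrow> 'a word set"
  where "words X = lists (Gen ` X \<union> Gen_inv ` X)"

inductive_set presentation_rel :: "'a set \<Rightarrow> ('a word \<times> 'a word) set \<Rightarrow> ('a word \<times> 'a word) set"
  for X R where
  refl: "w \<in> words X \<Longrightarrow> (w, w) \<in> presentation_rel X R"
| sym: "(u, v) \<in> presentation_rel X R \<Longrightarrow> (v, u) \<in> presentation_rel X R"
| trans: "(u, v) \<in> presentation_rel X R \<Longrightarrow> (v, w) \<in> presentation_rel X R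
    \<Longrightarrow> (u, w) \<in> presentation_rel X R"
| append: "(u, u') \<in> presentation_rel X R \<Longrightarrow> (v, v') \<in> presentation_rel X R
    \<Longrightarrow> (u @ v, u' @ v') \<in> presentation_rel X R"
| cancel_right: "x \<in> X \<Longrightarrow> ([Gen x, Gen_inv x], []) \<in> presentation_rel X R"
| cancel_left: "x \<in> X \<Longrightarrow> ([Gen_inv x, Gen x], []) \<in> presentation_rel X R"
| relator: "(u, v) \<in> R \<Longrightarrow> u \<in> words X \<Longrightarrow> v \<in> words X \<Longrightarrow> (u, v) \<in> presentation_rel X R"

definition presented_group :: "'a set \<Rightarrow> ('a word \<times> 'a word) set \<Rightarrow> 'a word set monoid"
  where "presented_group X R =
    \<lparr>carrier = words X // presentation_rel X R,
     monoid.mult = \<lambda>A B. \<Union>u\<in>A. \<Union>v\<in>B. presentation_rel X R `` {u @ v},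
     one = presentation_rel X R `` {[]}\<rparr>"

lemma words_append: "u @ v \<in> words X \<longleftrightarrow> u \<in> words X \<and> v \<in> words X"
  by (auto simp: words_def)

lemma equiv_presentation_rel: "equiv (words X) (presentation_rel X R)"
proof (rule equivI)
  show "presentation_rel X R \<subseteq> words X \<times> words X"
  proof (rule subrelI)
    fix u v assume "(u, v) \<in> presentation_rel X R"
    then show "(u, v) \<in> words X \<times> words X"
      by induction (auto simp: words_def)
  qed
  show "refl_on (words X) (presentation_rel X R)"
    by (auto simp: refl_on_def intro: presentation_rel.refl)
  show "sym (presentation_rel X R)"
    by (rule symI) (rule presentation_rel.sym)
  show "trans (presentation_rel X R)"
    by (rule transI) (rule presentation_rel.trans)
qed

lemma mult_presented_group:
  assumes "u \<in> words X" "v \<in> words X"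
  shows "presentation_rel X R `` {u} \<otimes>\<^bsub>presented_group X R\<^esub> presentation_rel X R `` {v}
    = presentation_rel X R `` {u @ v}"
proof -
  have "congruent2 (presentation_rel X R) (presentation_rel X R)
      (\<lambda>u v. presentation_rel X R `` {u @ v})"
    by (auto simp: congruent2_def intro!: equiv_class_eq[OF equiv_presentation_rel]
        intro: presentation_rel.append)
  from UN_equiv_class2[OF equiv_presentation_rel equiv_presentation_rel this assms]
  show ?thesis by (simp add: presented_group_def)
qed

fun letter_inv :: "'a letter \<Rightarrow> 'a letter"
  where "letter_inv (Gen x) = Gen_inv x" | "letter_inv (Gen_inv x) = Gen x"

lemma word_left_inverse:
  assumes "w \<in> words X"
  shows "rev (map letter_inv w) \<in> words X"
    and "(rev (map letter_inv w) @ w, []) \<in> presentation_rel X R"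
proof -
  have "rev (map letter_inv w) \<in> words X
      \<and> (rev (map letter_inv w) @ w, []) \<in> presentation_rel X R"
    using assms
  proof (induction w)
    case Nil
    then show ?case by (auto intro: presentation_rel.refl)
  next
    case (Cons a w)
    have a: "[a] \<in> words X" and w: "w \<in> words X"
      using Cons.prems by (auto simp: words_def)
    have IH: "rev (map letter_inv w) \<in> words X"
      "(rev (map letter_inv w) @ w, []) \<in> presentation_rel X R"
      using Cons.IH[OF w] by auto
    have a': "[letter_inv a] \<in> words X"
      using a by (auto simp: words_def)
    have c: "([letter_inv a, a], []) \<in> presentation_rel X R"
      using a by (auto simp: words_def intro: presentation_rel.intros)
    have "(rev (map letter_inv w) @ ([letter_inv a, a] @ w), rev (map letter_inv w) @ ([] @ w))
        \<in> presentation_rel X R"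
      by (intro presentation_rel.append presentation_rel.refl IH w c)
    with IH(2) have "(rev (map letter_inv w) @ [letter_inv a, a] @ w, []) \<in> presentation_rel X R"
      by (auto intro: presentation_rel.trans)
    with IH(1) a' show ?case
      by (simp add: words_append)
  qed
  then show "rev (map letter_inv w) \<in> words X"
    "(rev (map letter_inv w) @ w, []) \<in> presentation_rel X R" by auto
qed

lemma group_presented_group: "group (presented_group X R)"
proof (rule groupI)
  let ?G = "presented_group X R" and ?c = "\<lambda>w. presentation_rel X R `` {w}"
  have carr: "carrier ?G = ?c ` words X"
    by (auto simp: presented_group_def quotient_def)
  have nil: "[] \<in> words X" by (simp add: words_def)
  have one: "\<one>\<^bsub>?G\<^esub> = ?c []" by (simp add: presented_group_def)
  show "\<one>\<^bsub>?G\<^esub> \<in> carrier ?G" using carr one nil by blast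
  show "A \<otimes>\<^bsub>?G\<^esub> B \<in> carrier ?G" if "A \<in> carrier ?G" "B \<in> carrier ?G" for A B
    using that unfolding carr by (auto simp: mult_presented_group words_append)
  show "(A \<otimes>\<^bsub>?G\<^esub> B) \<otimes>\<^bsub>?G\<^esub> C = A \<otimes>\<^bsub>?G\<^esub> (B \<otimes>\<^bsub>?G\<^esub> C)"
    if "A \<in> carrier ?G" "B \<in> carrier ?G" "C \<in> carrier ?G" for A B C
    using that unfolding carr by (auto simp: mult_presented_group words_append)
  show "\<one>\<^bsub>?G\<^esub> \<otimes>\<^bsub>?G\<^esub> A = A" if "A \<in> carrier ?G" for A
    using that unfolding carr one by (auto simp: mult_presented_group nil)
  show "\<exists>B\<in>carrier ?G. B \<otimes>\<^bsub>?G\<^esub> A = \<one>\<^bsub>?G\<^esub>" if A: "A \<in> carrier ?G" for A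
  proof -
    obtain w where w: "w \<in> words X" "A = ?c w" using A carr by auto
    have "?c (rev (map letter_inv w)) \<otimes>\<^bsub>?G\<^esub> A = \<one>\<^bsub>?G\<^esub>"
      unfolding w(2) one using word_left_inverse[OF w(1)] w(1)
      by (simp add: mult_presented_group equiv_class_eq[OF equiv_presentation_rel])
    moreover have "?c (rev (map letter_inv w)) \<in> carrier ?G"
      using carr word_left_inverse(1)[OF w(1)] by blast
    ultimately show ?thesis by blast
  qed
qed


section \<open>Quandles\<close>

text \<open>\<^term>\<open>qop Q y x\<close> is the product written \<open>y * x\<close>; right translations are bijections.\<close>

record 'a quandle = "'a partial_object" +
  qop :: "'a \<Rightarrow> 'a \<Rightarrow> 'a"

definition is_quandle :: "('a, 'b) quandle_scheme \<Rightarrow> bool"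
  where "is_quandle Q \<longleftrightarrow>
    (\<forall>x\<in>carrier Q. qop Q x x = x) \<and>
    (\<forall>x\<in>carrier Q. bij_betw (\<lambda>y. qop Q y x) (carrier Q) (carrier Q)) \<and>
    (\<forall>x\<in>carrier Q. \<forall>y\<in>carrier Q. \<forall>z\<in>carrier Q.
       qop Q (qop Q z y) x = qop Q (qop Q z x) (qop Q y x))"

definition adjoint_group :: "('a, 'b) quandle_scheme \<Rightarrow> 'a word set monoid"
  where "adjoint_group Q = presented_group (carrier Q)
    {([Gen (qop Q y x)], [Gen_inv x, Gen y, Gen x]) | x y. x \<in> carrier Q \<and> y \<in> carrier Q}"

text \<open>Abelian groups are commutative groups in the sense of \<^locale>\<open>comm_group\<close> and hence
  written multiplicatively: the expression \<open>Ty + x - Tx\<close> reads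
  \<open>T y \<otimes> x \<otimes> inv (T x)\<close>, and \<open>1 - f\<close> reads \<open>\<lambda>x. x \<otimes> inv (f x)\<close>.\<close>

definition alexander_quandle :: "('a, 'b) monoid_scheme \<Rightarrow> ('a \<Rightarrow> 'a) \<Rightarrow> 'a quandle"
  where "alexander_quandle M T =
    \<lparr>carrier = carrier M, qop = \<lambda>y x. T y \<otimes>\<^bsub>M\<^esub> x \<otimes>\<^bsub>M\<^esub> inv\<^bsub>M\<^esub> (T x)\<rparr>"

definition one_minus :: "('a, 'b) monoid_scheme \<Rightarrow> ('a \<Rightarrow> 'a) \<Rightarrow> 'a \<Rightarrow> 'a"
  where "one_minus M f = (\<lambda>x\<in>carrier M. x \<otimes>\<^bsub>M\<^esub> inv\<^bsub>M\<^esub> (f x))"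

lemma auto_carrier: "T \<in> auto M \<Longrightarrow> x \<in> carrier M \<Longrightarrow> T x \<in> carrier M"
  by (auto simp: auto_def hom_def)

lemma auto_mult: "T \<in> auto M \<Longrightarrow> x \<in> carrier M \<Longrightarrow> y \<in> carrier M
    \<Longrightarrow> T (x \<otimes>\<^bsub>M\<^esub> y) = T x \<otimes>\<^bsub>M\<^esub> T y"
  by (auto simp: auto_def hom_def)

lemma auto_inv:
  assumes "group M" "T \<in> auto M" "x \<in> carrier M"
  shows "T (inv\<^bsub>M\<^esub> x) = inv\<^bsub>M\<^esub> (T x)"
proof -
  interpret group_hom M M T
    using assms by (simp add: group_hom_def group_hom_axioms_def auto_def)
  show ?thesis using assms by simp
qed

lemma (in comm_group) one_minus_hom:
  assumes "f \<in> hom G G"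
  shows "one_minus G f \<in> hom G G"
proof -
  interpret f: group_hom G G f
    using assms by (simp add: group_hom_def group_hom_axioms_def is_group)
  show ?thesis
  proof (rule homI)
    fix x y assume "x \<in> carrier G" "y \<in> carrier G"
    then show "one_minus G f (x \<otimes> y) = one_minus G f x \<otimes> one_minus G f y"
      by (simp add: one_minus_def inv_mult m_ac)
  qed (simp add: one_minus_def)
qed

lemma is_quandle_alexander_quandle:
  assumes "comm_group M" "T \<in> auto M"
  shows "is_quandle (alexander_quandle M T)"
proof -
  interpret comm_group M by fact
  note [simp] = auto_carrier[OF assms(2)] auto_mult[OF assms(2)] auto_inv[OF is_group assms(2)]
  have T: "bij_betw T (carrier M) (carrier M)"
    using assms(2) by (simp add: auto_def Bij_def)
  have idem: "T x \<otimes>\<^bsub>M\<^esub> x \<otimes>\<^bsub>M\<^esub> inv\<^bsub>M\<^esub> (T x) = x" if "x \<in> carrier M" for x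
    using that by (simp add: m_comm[of "T x" x] m_assoc)
  have trans: "bij_betw (\<lambda>y. T y \<otimes>\<^bsub>M\<^esub> x \<otimes>\<^bsub>M\<^esub> inv\<^bsub>M\<^esub> (T x)) (carrier M) (carrier M)"
    if x: "x \<in> carrier M" for x
  proof -
    have "bij_betw (\<lambda>y. y \<otimes>\<^bsub>M\<^esub> (x \<otimes>\<^bsub>M\<^esub> inv\<^bsub>M\<^esub> (T x))) (carrier M) (carrier M)"
      by (rule bij_betwI[where g = "\<lambda>y. y \<otimes>\<^bsub>M\<^esub> inv\<^bsub>M\<^esub> (x \<otimes>\<^bsub>M\<^esub> inv\<^bsub>M\<^esub> (T x))"])
        (use x in \<open>auto simp: m_assoc\<close>)
    from bij_betw_trans[OF T this] have
      "bij_betw (\<lambda>y. T y \<otimes>\<^bsub>M\<^esub> (x \<otimes>\<^bsub>M\<^esub> inv\<^bsub>M\<^esub> (T x))) (carrier M) (carrier M)"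
      by (simp add: comp_def)
    then show ?thesis
      by (rule iffD1[OF bij_betw_cong, rotated]) (use x in \<open>simp add: m_assoc\<close>)
  qed
  have dist: "T (T z \<otimes>\<^bsub>M\<^esub> y \<otimes>\<^bsub>M\<^esub> inv\<^bsub>M\<^esub> (T y)) \<otimes>\<^bsub>M\<^esub> x \<otimes>\<^bsub>M\<^esub> inv\<^bsub>M\<^esub> (T x) =
      T (T z \<otimes>\<^bsub>M\<^esub> x \<otimes>\<^bsub>M\<^esub> inv\<^bsub>M\<^esub> (T x)) \<otimes>\<^bsub>M\<^esub> (T y \<otimes>\<^bsub>M\<^esub> x \<otimes>\<^bsub>M\<^esub> inv\<^bsub>M\<^esub> (T x)) \<otimes>\<^bsub>M\<^esub>
      inv\<^bsub>M\<^esub> (T (T y \<otimes>\<^bsub>M\<^esub> x \<otimes>\<^bsub>M\<^esub> inv\<^bsub>M\<^esub> (T x)))"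
    if "x \<in> carrier M" "y \<in> carrier M" "z \<in> carrier M" for x y z
  proof -
    have cancel: "a \<otimes>\<^bsub>M\<^esub> (inv\<^bsub>M\<^esub> a \<otimes>\<^bsub>M\<^esub> b) = b" if "a \<in> carrier M" "b \<in> carrier M" for a b
      using that by (simp flip: m_assoc)
    define a b c d e g where "a = T (T z)" "b = T y" "c = T (T y)" "d = T x" "e = T (T x)" "g = x"
    then have carr: "a \<in> carrier M" "b \<in> carrier M" "c \<in> carrier M" "d \<in> carrier M"
      "e \<in> carrier M" "g \<in> carrier M"
      using that by auto
    have "a \<otimes>\<^bsub>M\<^esub> b \<otimes>\<^bsub>M\<^esub> inv\<^bsub>M\<^esub> c \<otimes>\<^bsub>M\<^esub> g \<otimes>\<^bsub>M\<^esub> inv\<^bsub>M\<^esub> d =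
      (a \<otimes>\<^bsub>M\<^esub> d \<otimes>\<^bsub>M\<^esub> inv\<^bsub>M\<^esub> e) \<otimes>\<^bsub>M\<^esub> (b \<otimes>\<^bsub>M\<^esub> g \<otimes>\<^bsub>M\<^esub> inv\<^bsub>M\<^esub> d) \<otimes>\<^bsub>M\<^esub>
      (inv\<^bsub>M\<^esub> c \<otimes>\<^bsub>M\<^esub> inv\<^bsub>M\<^esub> d \<otimes>\<^bsub>M\<^esub> e)"
    proof -
      have "(a \<otimes>\<^bsub>M\<^esub> d \<otimes>\<^bsub>M\<^esub> inv\<^bsub>M\<^esub> e) \<otimes>\<^bsub>M\<^esub> (b \<otimes>\<^bsub>M\<^esub> g \<otimes>\<^bsub>M\<^esub> inv\<^bsub>M\<^esub> d) \<otimes>\<^bsub>M\<^esub>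
        (inv\<^bsub>M\<^esub> c \<otimes>\<^bsub>M\<^esub> inv\<^bsub>M\<^esub> d \<otimes>\<^bsub>M\<^esub> e) =
        (d \<otimes>\<^bsub>M\<^esub> inv\<^bsub>M\<^esub> d) \<otimes>\<^bsub>M\<^esub> ((e \<otimes>\<^bsub>M\<^esub> inv\<^bsub>M\<^esub> e) \<otimes>\<^bsub>M\<^esub>
        (a \<otimes>\<^bsub>M\<^esub> (b \<otimes>\<^bsub>M\<^esub> (inv\<^bsub>M\<^esub> c \<otimes>\<^bsub>M\<^esub> (g \<otimes>\<^bsub>M\<^esub> inv\<^bsub>M\<^esub> d)))))"
        using carr by (simp only: m_ac m_closed inv_closed)
      with carr show ?thesis by (simp add: m_assoc)
    qed
    then show ?thesis
      using that carr unfolding a_b_c_d_e_g_def by (simp add: inv_mult)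
  qed
  show ?thesis
    unfolding is_quandle_def alexander_quandle_def
    using idem trans dist by simp
qed


section \<open>Tensor products over the integers\<close>

definition tensor_rels ::
  "('a, 'c) monoid_scheme \<Rightarrow> ('b, 'd) monoid_scheme \<Rightarrow> ('a \<times> 'b \<Rightarrow>\<^sub>0 int) set"
  where "tensor_rels M N =
    {frag_of (x \<otimes>\<^bsub>M\<^esub> x', y) - frag_of (x, y) - frag_of (x', y) | x x' y.
       x \<in> carrier M \<and> x' \<in> carrier M \<and> y \<in> carrier N} \<union>
    {frag_of (x, y \<otimes>\<^bsub>N\<^esub> y') - frag_of (x, y) - frag_of (x, y') | x y y'.
       x \<in> carrier M \<and> y \<in> carrier N \<and> y' \<in> carrier N}"

definition tensor_ker ::
  "('a, 'c) monoid_scheme \<Rightarrow> ('b, 'd) monoid_scheme \<Rightarrow> ('a \<times> 'b \<Rightarrow>\<^sub>0 int) set"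
  where "tensor_ker M N =
    generate (free_Abelian_group (carrier M \<times> carrier N)) (tensor_rels M N)"

definition tensor_product ::
  "('a, 'c) monoid_scheme \<Rightarrow> ('b, 'd) monoid_scheme \<Rightarrow> ('a \<times> 'b \<Rightarrow>\<^sub>0 int) set monoid"
  where "tensor_product M N =
    free_Abelian_group (carrier M \<times> carrier N) Mod tensor_ker M N"

definition pure_tensor ::
  "('a, 'c) monoid_scheme \<Rightarrow> ('b, 'd) monoid_scheme \<Rightarrow> 'a \<Rightarrow> 'b \<Rightarrow> ('a \<times> 'b \<Rightarrow>\<^sub>0 int) set"
  where "pure_tensor M N x y =
    tensor_ker M N #>\<^bsub>free_Abelian_group (carrier M \<times> carrier N)\<^esub> frag_of (x, y)"

lemma free_Abelian_group_diff2:
  assumes "a \<in> carrier (free_Abelian_group A)" "b \<in> carrier (free_Abelian_group A)"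
    "c \<in> carrier (free_Abelian_group A)"
  shows "a - b - c \<in> carrier (free_Abelian_group A)"
proof -
  have "Poly_Mapping.keys (a - b - c) \<subseteq> Poly_Mapping.keys a \<union> Poly_Mapping.keys b \<union> Poly_Mapping.keys c"
    using keys_diff[of "a - b" c] keys_diff[of a b] by blast
  also have "\<dots> \<subseteq> A" using assms by simp
  finally show ?thesis by simp
qed

lemma tensor_rels_subset:
  assumes "comm_group M" "comm_group N"
  shows "tensor_rels M N \<subseteq> carrier (free_Abelian_group (carrier M \<times> carrier N))"
proof -
  interpret M: comm_group M by fact
  interpret N: comm_group N by fact
  let ?F = "free_Abelian_group (carrier M \<times> carrier N)"
  show ?thesis
    unfolding tensor_rels_def
    by (auto intro!: free_Abelian_group_diff2 simp del: carrier_free_Abelian_group_iff)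
qed

lemma normal_tensor_ker:
  assumes "comm_group M" "comm_group N"
  shows "tensor_ker M N \<lhd> free_Abelian_group (carrier M \<times> carrier N)"
  unfolding tensor_ker_def
  by (intro comm_group.subgroup_imp_normal abelian_free_Abelian_group group.generate_is_subgroup
      group_free_Abelian_group tensor_rels_subset assms)

lemma comm_group_tensor_product:
  assumes "comm_group M" "comm_group N"
  shows "comm_group (tensor_product M N)"
  unfolding tensor_product_def
  by (intro comm_group.abelian_FactGroup abelian_free_Abelian_group
      normal_imp_subgroup normal_tensor_ker assms)

lemma tensor_proj_hom:
  assumes "comm_group M" "comm_group N"
  shows "(\<lambda>a. tensor_ker M N #>\<^bsub>free_Abelian_group (carrier M \<times> carrier N)\<^esub> a)
    \<in> hom (free_Abelian_group (carrier M \<times> carrier N)) (tensor_product M N)"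
  unfolding tensor_product_def by (intro normal.r_coset_hom_Mod normal_tensor_ker assms)

lemma pure_tensor_closed:
  assumes "comm_group M" "comm_group N" "x \<in> carrier M" "y \<in> carrier N"
  shows "pure_tensor M N x y \<in> carrier (tensor_product M N)"
  unfolding pure_tensor_def
  by (rule hom_in_carrier[OF tensor_proj_hom]) (use assms in auto)

lemma pure_tensor_mult:
  assumes "comm_group M" "comm_group N"
  shows pure_tensor_mult_left: "x \<in> carrier M \<Longrightarrow> x' \<in> carrier M \<Longrightarrow> y \<in> carrier N \<Longrightarrow>
      pure_tensor M N (x \<otimes>\<^bsub>M\<^esub> x') y =
      pure_tensor M N x y \<otimes>\<^bsub>tensor_product M N\<^esub> pure_tensor M N x' y"
    and pure_tensor_mult_right: "x \<in> carrier M \<Longrightarrow> y \<in> carrier N \<Longrightarrow> y' \<in> carrier N \<Longrightarrow>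
      pure_tensor M N x (y \<otimes>\<^bsub>N\<^esub> y') =
      pure_tensor M N x y \<otimes>\<^bsub>tensor_product M N\<^esub> pure_tensor M N x y'"
proof -
  interpret M: comm_group M by fact
  interpret N: comm_group N by fact
  let ?F = "free_Abelian_group (carrier M \<times> carrier N)"
  let ?p = "\<lambda>a. tensor_ker M N #>\<^bsub>?F\<^esub> a"
  interpret F: comm_group ?F by (rule abelian_free_Abelian_group)
  interpret T: comm_group "tensor_product M N" by (rule comm_group_tensor_product) fact+
  interpret p: group_hom ?F "tensor_product M N" ?p
    by (simp add: group_hom_def group_hom_axioms_def tensor_proj_hom assms T.is_group)
  have rel: "?p a = ?p b \<otimes>\<^bsub>tensor_product M N\<^esub> ?p c"
    if r: "a - b - c \<in> tensor_rels M N" and bc: "b \<in> carrier ?F" "c \<in> carrier ?F" for a b c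
  proof -
    have k: "a - b - c \<in> tensor_ker M N"
      unfolding tensor_ker_def by (rule generate.incl) fact
    have c: "a - b - c \<in> carrier ?F"
      using r tensor_rels_subset[OF assms] by blast
    have "?p (a - b - c) = \<one>\<^bsub>tensor_product M N\<^esub>"
      unfolding tensor_product_def one_FactGroup
      by (rule F.coset_join2) (use k c normal_imp_subgroup[OF normal_tensor_ker[OF assms]] in auto)
    moreover have "?p (((a - b - c) \<otimes>\<^bsub>?F\<^esub> b) \<otimes>\<^bsub>?F\<^esub> c) =
        (?p (a - b - c) \<otimes>\<^bsub>tensor_product M N\<^esub> ?p b) \<otimes>\<^bsub>tensor_product M N\<^esub> ?p c"
      using bc c by (simp only: p.hom_mult F.m_closed)
    ultimately show ?thesis using bc by simp
  qed
  show "pure_tensor M N (x \<otimes>\<^bsub>M\<^esub> x') y =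
      pure_tensor M N x y \<otimes>\<^bsub>tensor_product M N\<^esub> pure_tensor M N x' y"
    if "x \<in> carrier M" "x' \<in> carrier M" "y \<in> carrier N"
    unfolding pure_tensor_def by (rule rel) (use that in \<open>auto simp: tensor_rels_def\<close>)
  show "pure_tensor M N x (y \<otimes>\<^bsub>N\<^esub> y') =
      pure_tensor M N x y \<otimes>\<^bsub>tensor_product M N\<^esub> pure_tensor M N x y'"
    if "x \<in> carrier M" "y \<in> carrier N" "y' \<in> carrier N"
    unfolding pure_tensor_def by (rule rel) (use that in \<open>auto simp: tensor_rels_def\<close>)
qed

lemma tensor_product_universal:
  assumes "comm_group M" "comm_group N" "comm_group C"
    and closed: "\<And>x y. x \<in> carrier M \<Longrightarrow> y \<in> carrier N \<Longrightarrow> f x y \<in> carrier C"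
    and left: "\<And>x x' y. x \<in> carrier M \<Longrightarrow> x' \<in> carrier M \<Longrightarrow> y \<in> carrier N \<Longrightarrow>
      f (x \<otimes>\<^bsub>M\<^esub> x') y = f x y \<otimes>\<^bsub>C\<^esub> f x' y"
    and right: "\<And>x y y'. x \<in> carrier M \<Longrightarrow> y \<in> carrier N \<Longrightarrow> y' \<in> carrier N \<Longrightarrow>
      f x (y \<otimes>\<^bsub>N\<^esub> y') = f x y \<otimes>\<^bsub>C\<^esub> f x y'"
  obtains h where "h \<in> hom (tensor_product M N) C"
    "\<And>x y. x \<in> carrier M \<Longrightarrow> y \<in> carrier N \<Longrightarrow> h (pure_tensor M N x y) = f x y"
proof -
  interpret M: comm_group M by fact
  interpret N: comm_group N by fact
  interpret C: comm_group C by fact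
  let ?F = "free_Abelian_group (carrier M \<times> carrier N)"
  interpret F: comm_group ?F by (rule abelian_free_Abelian_group)
  have f: "case_prod f ` (carrier M \<times> carrier N) \<subseteq> carrier C"
    using closed by auto
  obtain g where g: "g \<in> hom ?F C"
    "\<And>z. z \<in> carrier M \<times> carrier N \<Longrightarrow> g (frag_of z) = case_prod f z"
    by (rule C.free_Abelian_group_universal[OF f]) blast
  interpret g: group_hom ?F C g
    by (simp add: group_hom_def group_hom_axioms_def g(1) C.is_group)
  have rel: "z \<in> kernel ?F C g" if "z = a - b - c" "a \<in> carrier ?F" "b \<in> carrier ?F"
    "c \<in> carrier ?F" "g a = g b \<otimes>\<^bsub>C\<^esub> g c" for z a b c
  proof -
    have z: "z \<in> carrier ?F"
      unfolding that(1) by (intro free_Abelian_group_diff2 that)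
    have gc: "g z \<in> carrier C" "g b \<in> carrier C" "g c \<in> carrier C"
      using z that by (simp_all only: g.hom_closed)
    have "a = (z \<otimes>\<^bsub>?F\<^esub> b) \<otimes>\<^bsub>?F\<^esub> c"
      using that(1) by simp
    then have "g a = g ((z \<otimes>\<^bsub>?F\<^esub> b) \<otimes>\<^bsub>?F\<^esub> c)" by (rule arg_cong)
    also have "\<dots> = (g z \<otimes>\<^bsub>C\<^esub> g b) \<otimes>\<^bsub>C\<^esub> g c"
      using that(3,4) z by (simp only: g.hom_mult F.m_closed)
    finally have "g a = (g z \<otimes>\<^bsub>C\<^esub> g b) \<otimes>\<^bsub>C\<^esub> g c" .
    then have "g z \<otimes>\<^bsub>C\<^esub> (g b \<otimes>\<^bsub>C\<^esub> g c) = g b \<otimes>\<^bsub>C\<^esub> g c"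
      using gc that(5) by (simp add: C.m_assoc)
    then have "g z = \<one>\<^bsub>C\<^esub>"
      using gc by (metis C.l_cancel_one C.m_closed C.m_comm)
    with z show ?thesis by (simp add: kernel_def)
  qed
  have "tensor_rels M N \<subseteq> kernel ?F C g"
    unfolding tensor_rels_def
    by (auto intro!: rel[OF HOL.refl] simp: g(2) left right)
  then have "tensor_ker M N \<subseteq> kernel ?F C g"
    unfolding tensor_ker_def by (rule F.generate_subgroup_incl[OF _ g.subgroup_kernel])
  then obtain h where "h \<in> hom (tensor_product M N) C"
    "\<And>a. a \<in> carrier ?F \<Longrightarrow> h (tensor_ker M N #>\<^bsub>?F\<^esub> a) = g a"
    unfolding tensor_product_def
    by (rule g.FactGroup_universal_kernel[OF normal_tensor_ker[OF assms(1,2)]]) blast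
  with that[of h] show ?thesis
    by (simp add: pure_tensor_def g(2))
qed

lemma tensor_product_hom_eqI:
  assumes "comm_group M" "comm_group N" "comm_group C"
    and "h \<in> hom (tensor_product M N) C" "h' \<in> hom (tensor_product M N) C"
    and eq: "\<And>x y. x \<in> carrier M \<Longrightarrow> y \<in> carrier N \<Longrightarrow>
      h (pure_tensor M N x y) = h' (pure_tensor M N x y)"
    and "t \<in> carrier (tensor_product M N)"
  shows "h t = h' t"
proof -
  interpret C: comm_group C by fact
  let ?F = "free_Abelian_group (carrier M \<times> carrier N)"
  let ?p = "\<lambda>a. tensor_ker M N #>\<^bsub>?F\<^esub> a"
  interpret F: comm_group ?F by (rule abelian_free_Abelian_group)
  interpret p: group_hom ?F C "h \<circ> ?p"
    using hom_compose[OF tensor_proj_hom[OF assms(1,2)] assms(4)]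
    by (simp add: group_hom_def group_hom_axioms_def C.is_group)
  interpret p': group_hom ?F C "h' \<circ> ?p"
    using hom_compose[OF tensor_proj_hom[OF assms(1,2)] assms(5)]
    by (simp add: group_hom_def group_hom_axioms_def C.is_group)
  obtain z where z: "z \<in> carrier ?F" "t = ?p z"
    using assms(7) by (auto simp: tensor_product_def carrier_FactGroup)
  from z(1) have "Poly_Mapping.keys z \<subseteq> carrier M \<times> carrier N" by simp
  then have "(h \<circ> ?p) z = (h' \<circ> ?p) z"
  proof (induction z rule: free_Abelian_group_induct[consumes 1])
    case 1
    show ?case using p.hom_one p'.hom_one by simp
  next
    case (2 x y)
    have d: "x - y = x \<otimes>\<^bsub>?F\<^esub> inv\<^bsub>?F\<^esub> y" using 2(2) by simp
    have "x \<in> carrier ?F" "y \<in> carrier ?F" using 2 by auto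
    then show ?case
      unfolding d using 2(3,4) by (simp only: p.hom_mult p.hom_inv p'.hom_mult p'.hom_inv F.inv_closed)
  next
    case (3 a)
    then show ?case using eq by (auto simp: pure_tensor_def)
  qed
  with z(2) show ?thesis by simp
qed


section \<open>The group F(M, T)\<close>

text \<open>Existence and uniqueness of the map below is lemma \<open>tau_ex1\<close>.\<close>

definition tau :: "('a, 'b) monoid_scheme \<Rightarrow> ('a \<Rightarrow> 'a)
    \<Rightarrow> ('a \<times> 'a \<Rightarrow>\<^sub>0 int) set \<Rightarrow> ('a \<times> 'a \<Rightarrow>\<^sub>0 int) set"
  where "tau M T = (THE t. t \<in> hom (tensor_product M M) (tensor_product M M) \<and>
    t \<in> extensional (carrier (tensor_product M M)) \<and>
    (\<forall>x\<in>carrier M. \<forall>y\<in>carrier M. t (pure_tensor M M x y) = pure_tensor M M (T y) x))"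

lemma tau_ex1:
  assumes "comm_group M" "T \<in> auto M"
  shows "\<exists>!t. t \<in> hom (tensor_product M M) (tensor_product M M) \<and>
    t \<in> extensional (carrier (tensor_product M M)) \<and>
    (\<forall>x\<in>carrier M. \<forall>y\<in>carrier M. t (pure_tensor M M x y) = pure_tensor M M (T y) x)"
proof -
  let ?P = "tensor_product M M"
  note P = comm_group_tensor_product[OF assms(1,1)]
  obtain h where h: "h \<in> hom ?P ?P"
    "\<And>x y. x \<in> carrier M \<Longrightarrow> y \<in> carrier M \<Longrightarrow> h (pure_tensor M M x y) = pure_tensor M M (T y) x"
    by (rule tensor_product_universal[OF assms(1,1) P, of "\<lambda>x y. pure_tensor M M (T y) x"])
      (simp_all add: pure_tensor_closed pure_tensor_mult assms auto_carrier[OF assms(2)]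
        auto_mult[OF assms(2)])
  show ?thesis
  proof (rule ex1I[of _ "restrict h (carrier ?P)"], intro conjI ballI)
    show "restrict h (carrier ?P) \<in> hom ?P ?P"
      using h(1) group.is_monoid[OF comm_group.axioms(2)[OF P]]
      by (auto simp: hom_def monoid.m_closed)
    show "restrict h (carrier ?P) \<in> extensional (carrier ?P)" by simp
    show "restrict h (carrier ?P) (pure_tensor M M x y) = pure_tensor M M (T y) x"
      if "x \<in> carrier M" "y \<in> carrier M" for x y
      using that h(2) pure_tensor_closed[OF assms(1,1)] by simp
  next
    fix t assume t: "t \<in> hom ?P ?P \<and> t \<in> extensional (carrier ?P) \<and>
      (\<forall>x\<in>carrier M. \<forall>y\<in>carrier M. t (pure_tensor M M x y) = pure_tensor M M (T y) x)"
    then have "t u = h u" if "u \<in> carrier ?P" for u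
      using tensor_product_hom_eqI[OF assms(1,1) P _ h(1) _ that, of t] h(2) by simp
    with t show "t = restrict h (carrier ?P)"
      by (intro extensionalityI[where A = "carrier ?P"]) auto
  qed
qed

lemma tau_hom:
  "comm_group M \<Longrightarrow> T \<in> auto M \<Longrightarrow> tau M T \<in> hom (tensor_product M M) (tensor_product M M)"
  and tau_pure_tensor:
  "comm_group M \<Longrightarrow> T \<in> auto M \<Longrightarrow> x \<in> carrier M \<Longrightarrow> y \<in> carrier M \<Longrightarrow>
    tau M T (pure_tensor M M x y) = pure_tensor M M (T y) x"
  using theI'[OF tau_ex1, of M T] unfolding tau_def by blast+

definition im_one_minus_tau ::
  "('a, 'b) monoid_scheme \<Rightarrow> ('a \<Rightarrow> 'a) \<Rightarrow> ('a \<times> 'a \<Rightarrow>\<^sub>0 int) set set"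
  where "im_one_minus_tau M T =
    one_minus (tensor_product M M) (tau M T) ` carrier (tensor_product M M)"

definition S_group ::
  "('a, 'b) monoid_scheme \<Rightarrow> ('a \<Rightarrow> 'a) \<Rightarrow> ('a \<times> 'a \<Rightarrow>\<^sub>0 int) set set monoid"
  where "S_group M T = tensor_product M M Mod im_one_minus_tau M T"

definition S_class :: "('a, 'b) monoid_scheme \<Rightarrow> ('a \<Rightarrow> 'a) \<Rightarrow> 'a \<Rightarrow> 'a
    \<Rightarrow> ('a \<times> 'a \<Rightarrow>\<^sub>0 int) set set"
  where "S_class M T x y = im_one_minus_tau M T #>\<^bsub>tensor_product M M\<^esub> pure_tensor M M x y"

lemma subgroup_im_one_minus_tau:
  assumes "comm_group M" "T \<in> auto M"
  shows "subgroup (im_one_minus_tau M T) (tensor_product M M)"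
proof -
  interpret P: comm_group "tensor_product M M"
    by (intro comm_group_tensor_product assms)
  interpret group_hom "tensor_product M M" "tensor_product M M"
    "one_minus (tensor_product M M) (tau M T)"
    by (simp add: group_hom_def group_hom_axioms_def P.one_minus_hom tau_hom assms P.is_group)
  show ?thesis
    unfolding im_one_minus_tau_def by (rule img_is_subgroup)
qed

lemma comm_group_S_group:
  assumes "comm_group M" "T \<in> auto M"
  shows "comm_group (S_group M T)"
  unfolding S_group_def
  by (intro comm_group.abelian_FactGroup comm_group_tensor_product
      subgroup_im_one_minus_tau assms)

lemma S_class_facts:
  assumes "comm_group M" "T \<in> auto M"
  shows S_class_closed: "x \<in> carrier M \<Longrightarrow> y \<in> carrier M \<Longrightarrow> S_class M T x y \<in> carrier (S_group M T)"
    and S_class_mult_left: "x \<in> carrier M \<Longrightarrow> x' \<in> carrier M \<Longrightarrow> y \<in> carrier M \<Longrightarrow>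
      S_class M T (x \<otimes>\<^bsub>M\<^esub> x') y = S_class M T x y \<otimes>\<^bsub>S_group M T\<^esub> S_class M T x' y"
    and S_class_mult_right: "x \<in> carrier M \<Longrightarrow> y \<in> carrier M \<Longrightarrow> y' \<in> carrier M \<Longrightarrow>
      S_class M T x (y \<otimes>\<^bsub>M\<^esub> y') = S_class M T x y \<otimes>\<^bsub>S_group M T\<^esub> S_class M T x y'"
    and S_class_swap: "x \<in> carrier M \<Longrightarrow> y \<in> carrier M \<Longrightarrow> S_class M T (T y) x = S_class M T x y"
proof -
  let ?P = "tensor_product M M"
  interpret P: comm_group ?P by (intro comm_group_tensor_product assms)
  have N: "im_one_minus_tau M T \<lhd> ?P"
    by (intro P.subgroup_imp_normal subgroup_im_one_minus_tau assms)
  have p: "(\<lambda>a. im_one_minus_tau M T #>\<^bsub>?P\<^esub> a) \<in> hom ?P (S_group M T)"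
    unfolding S_group_def by (rule normal.r_coset_hom_Mod[OF N])
  note c = pure_tensor_closed[OF assms(1,1)]
  show "x \<in> carrier M \<Longrightarrow> y \<in> carrier M \<Longrightarrow> S_class M T x y \<in> carrier (S_group M T)"
    unfolding S_class_def by (rule hom_in_carrier[OF p c])
  show "x \<in> carrier M \<Longrightarrow> x' \<in> carrier M \<Longrightarrow> y \<in> carrier M \<Longrightarrow>
      S_class M T (x \<otimes>\<^bsub>M\<^esub> x') y = S_class M T x y \<otimes>\<^bsub>S_group M T\<^esub> S_class M T x' y"
    unfolding S_class_def by (simp add: pure_tensor_mult assms c hom_mult[OF p])
  show "x \<in> carrier M \<Longrightarrow> y \<in> carrier M \<Longrightarrow> y' \<in> carrier M \<Longrightarrow>
      S_class M T x (y \<otimes>\<^bsub>M\<^esub> y') = S_class M T x y \<otimes>\<^bsub>S_group M T\<^esub> S_class M T x y'"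
    unfolding S_class_def by (simp add: pure_tensor_mult assms c hom_mult[OF p])
  show "S_class M T (T y) x = S_class M T x y" if xy: "x \<in> carrier M" "y \<in> carrier M"
  proof -
    have Ty: "pure_tensor M M (T y) x \<in> carrier ?P"
      using xy c auto_carrier[OF assms(2)] by simp
    have "one_minus ?P (tau M T) (pure_tensor M M x y) \<in> im_one_minus_tau M T"
      unfolding im_one_minus_tau_def using xy c by blast
    then have m: "pure_tensor M M x y \<otimes>\<^bsub>?P\<^esub> inv\<^bsub>?P\<^esub> pure_tensor M M (T y) x \<in> im_one_minus_tau M T"
      using xy c by (simp add: one_minus_def tau_pure_tensor assms)
    have "pure_tensor M M x y =
        (pure_tensor M M x y \<otimes>\<^bsub>?P\<^esub> inv\<^bsub>?P\<^esub> pure_tensor M M (T y) x) \<otimes>\<^bsub>?P\<^esub> pure_tensor M M (T y) x"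
      using xy c Ty by (simp add: P.m_assoc)
    with m have "pure_tensor M M x y \<in> im_one_minus_tau M T #>\<^bsub>?P\<^esub> pure_tensor M M (T y) x"
      unfolding r_coset_def by blast
    then show ?thesis
      unfolding S_class_def
      by (intro P.repr_independence Ty subgroup_im_one_minus_tau assms)
  qed
qed

definition F_group :: "('a, 'b) monoid_scheme \<Rightarrow> ('a \<Rightarrow> 'a)
    \<Rightarrow> (int \<times> 'a \<times> ('a \<times> 'a \<Rightarrow>\<^sub>0 int) set set) monoid"
  where "F_group M T =
    \<lparr>carrier = UNIV \<times> carrier M \<times> carrier (S_group M T),
     monoid.mult = \<lambda>(k, x, \<alpha>) (m, y, \<beta>).
       let x' = (T [^]\<^bsub>AutoGroup M\<^esub> m) x in
       (k + m, x' \<otimes>\<^bsub>M\<^esub> y, \<alpha> \<otimes>\<^bsub>S_group M T\<^esub> \<beta> \<otimes>\<^bsub>S_group M T\<^esub> S_class M T x' y),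
     one = (0, \<one>\<^bsub>M\<^esub>, \<one>\<^bsub>S_group M T\<^esub>)\<rparr>"

lemma group_F_group:
  assumes "comm_group M" "T \<in> auto M"
  shows "group (F_group M T)"
proof -
  interpret M: comm_group M by fact
  interpret S: comm_group "S_group M T" by (rule comm_group_S_group) fact+
  interpret A: group "AutoGroup M" by (rule M.AutoGroup)
  let ?T = "\<lambda>m::int. T [^]\<^bsub>AutoGroup M\<^esub> m"
  have carrA: "carrier (AutoGroup M) = auto M"
    by (simp add: AutoGroup_def)
  have pow: "?T m \<in> auto M" for m
    using assms(2) A.int_pow_closed[of T m] by (simp add: carrA)
  have comp: "(f \<otimes>\<^bsub>AutoGroup M\<^esub> g) x = f (g x)"
    if "f \<in> auto M" "g \<in> auto M" "x \<in> carrier M" for f g x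
    using that by (simp add: AutoGroup_def BijGroup_def auto_def compose_def)
  have pow_add: "?T (m + n) x = ?T m (?T n x)" if "x \<in> carrier M" for m n x
    using that assms(2) comp[OF pow pow] by (simp add: A.int_pow_mult carrA)
  have pow_0: "?T 0 x = x" and Auto_one: "\<one>\<^bsub>AutoGroup M\<^esub> x = x" if "x \<in> carrier M" for x
    using that by (simp_all add: AutoGroup_def BijGroup_def)
  have pow_1: "?T 1 = T"
    using assms(2) by (simp add: carrA)
  note cl [simp] = auto_carrier[OF pow] S_class_closed[OF assms]
  note tm [simp] = auto_mult[OF pow]
  have one_left: "S_class M T \<one>\<^bsub>M\<^esub> y = \<one>\<^bsub>S_group M T\<^esub>" if "y \<in> carrier M" for y
    using S_class_mult_left[OF assms, of "\<one>\<^bsub>M\<^esub>" "\<one>\<^bsub>M\<^esub>" y] that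
    by (metis M.l_one M.one_closed S.l_cancel_one' S_class_closed[OF assms])
  have Tone: "?T m \<one>\<^bsub>M\<^esub> = \<one>\<^bsub>M\<^esub>" for m
    using pow[of m] by (simp add: auto_def hom_one M.is_group)
  have STT: "S_class M T (T x) (T y) = S_class M T x y" if "x \<in> carrier M" "y \<in> carrier M" for x y
    using that S_class_swap[OF assms] auto_carrier[OF assms(2)] by metis
  have inv: "S_class M T (?T m x) (?T m y) = S_class M T x y"
    if "x \<in> carrier M" "y \<in> carrier M" for m x y
  proof (induction m rule: int_induct[where k = 0])
    case base
    show ?case using that by (simp only: pow_0)
  next
    case (step1 i)
    then show ?case
      using that pow_add[of _ 1 i] pow_1 by (simp add: STT add.commute)
  next
    case (step2 i)
    then show ?case
      using that pow_add[of _ 1 "i - 1"] pow_1 STT[of "?T (i - 1) x" "?T (i - 1) y"] by simp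
  qed
  have carr: "carrier (F_group M T) = UNIV \<times> carrier M \<times> carrier (S_group M T)"
    and one: "\<one>\<^bsub>F_group M T\<^esub> = (0, \<one>\<^bsub>M\<^esub>, \<one>\<^bsub>S_group M T\<^esub>)"
    and mult: "(k, x, \<alpha>) \<otimes>\<^bsub>F_group M T\<^esub> (m, y, \<beta>) =
      (k + m, ?T m x \<otimes>\<^bsub>M\<^esub> y, \<alpha> \<otimes>\<^bsub>S_group M T\<^esub> \<beta> \<otimes>\<^bsub>S_group M T\<^esub> S_class M T (?T m x) y)"
    for k x \<alpha> m y \<beta>
    by (simp_all add: F_group_def Let_def)
  show ?thesis
  proof (rule groupI)
    show "\<one>\<^bsub>F_group M T\<^esub> \<in> carrier (F_group M T)"
      by (simp add: carr one)
    show "a \<otimes>\<^bsub>F_group M T\<^esub> b \<in> carrier (F_group M T)"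
      if "a \<in> carrier (F_group M T)" "b \<in> carrier (F_group M T)" for a b
      using that by (auto simp: carr mult)
    show "\<one>\<^bsub>F_group M T\<^esub> \<otimes>\<^bsub>F_group M T\<^esub> a = a" if "a \<in> carrier (F_group M T)" for a
      using that by (auto simp: carr one mult Tone one_left)
    show "(a \<otimes>\<^bsub>F_group M T\<^esub> b) \<otimes>\<^bsub>F_group M T\<^esub> c = a \<otimes>\<^bsub>F_group M T\<^esub> (b \<otimes>\<^bsub>F_group M T\<^esub> c)"
      if abc: "a \<in> carrier (F_group M T)" "b \<in> carrier (F_group M T)" "c \<in> carrier (F_group M T)"
      for a b c
    proof -
      obtain k x \<alpha> m y \<beta> n z \<gamma> where a: "a = (k, x, \<alpha>)" and b: "b = (m, y, \<beta>)" and c: "c = (n, z, \<gamma>)"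
        by (cases a, cases b, cases c) auto
      have in_carr: "x \<in> carrier M" "y \<in> carrier M" "z \<in> carrier M" "\<alpha> \<in> carrier (S_group M T)"
        "\<beta> \<in> carrier (S_group M T)" "\<gamma> \<in> carrier (S_group M T)"
        using abc by (auto simp: a b c carr)
      have p: "?T (m + n) x = ?T n (?T m x)"
        using in_carr pow_add[of x n m] by (simp add: add.commute)
      show ?thesis
        unfolding a b c mult p
        using in_carr
        by (simp add: M.m_assoc add.assoc S_class_mult_left[OF assms] S_class_mult_right[OF assms]
            inv S.m_ac)
    qed
    show "\<exists>b\<in>carrier (F_group M T). b \<otimes>\<^bsub>F_group M T\<^esub> a = \<one>\<^bsub>F_group M T\<^esub>"
      if abc: "a \<in> carrier (F_group M T)" for a
    proof -
      obtain k x \<alpha> where a: "a = (k, x, \<alpha>)" by (cases a)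
      have in_carr: "x \<in> carrier M" "\<alpha> \<in> carrier (S_group M T)"
        using abc by (auto simp: a carr)
      define y where "y = ?T (- k) (inv\<^bsub>M\<^esub> x)"
      have y: "y \<in> carrier M" "?T k y = inv\<^bsub>M\<^esub> x"
        using in_carr pow_add[of "inv\<^bsub>M\<^esub> x" k "- k"] by (simp_all add: y_def Auto_one)
      define s where "s = S_class M T (inv\<^bsub>M\<^esub> x) x"
      have s: "s \<in> carrier (S_group M T)" using in_carr by (simp add: s_def)
      let ?b = "(- k, y, inv\<^bsub>S_group M T\<^esub> (\<alpha> \<otimes>\<^bsub>S_group M T\<^esub> s))"
      have "?b \<otimes>\<^bsub>F_group M T\<^esub> a = \<one>\<^bsub>F_group M T\<^esub>"
        unfolding a mult one y(2) s_def[symmetric]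
        using in_carr s by (simp add: S.m_assoc)
      moreover have "?b \<in> carrier (F_group M T)"
        using in_carr y s by (simp add: carr)
      ultimately show ?thesis by blast
    qed
  qed
qed

end

(* The generators e x of the adjoint group go to (1, x, 0). For the inverse put g x = (e 0)^-1 (e x).
   Conjugation by g x translates the generators, e z |-> e (z + (1 - T) x), so
   lam x y = (g x) (g y) (g (x + y))^-1 is central. Applying the translation to e x and e 0 gives
   (g y) (g x) = lam ((1 - T) y) x (g x) (g y), so lam ((1 - T) y) x is a commutator in a group of
   class two and thus biadditive in x and y. As 1 - T is onto, lam is biadditive, and comparing the
   two expressions for the commutator gives lam (T y) x = lam x y. Hence lam factors through
   S(M, T), and (k, x, a) |-> (e 0)^k (g x) (lam a) is the inverse. *)

theory Submission
  imports Defs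
begin

section \<open>Universal property of presented groups\<close>

primrec letter_eval :: "('c, 'd) monoid_scheme \<Rightarrow> ('a \<Rightarrow> 'c) \<Rightarrow> 'a letter \<Rightarrow> 'c" where
  "letter_eval H f (Gen x) = f x"
| "letter_eval H f (Gen_inv x) = inv\<^bsub>H\<^esub> f x"

primrec word_eval :: "('c, 'd) monoid_scheme \<Rightarrow> ('a \<Rightarrow> 'c) \<Rightarrow> 'a word \<Rightarrow> 'c" where
  "word_eval H f [] = \<one>\<^bsub>H\<^esub>"
| "word_eval H f (a # w) = letter_eval H f a \<otimes>\<^bsub>H\<^esub> word_eval H f w"

context group
begin

lemma letter_eval_closed:
  assumes "f \<in> X \<rightarrow> carrier G" "[a] \<in> words X"
  shows "letter_eval G f a \<in> carrier G"
proof -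
  consider x where "x \<in> X" "a = Gen x" | x where "x \<in> X" "a = Gen_inv x"
    using assms(2) by (auto simp: words_def)
  then show ?thesis
  proof cases
    case 1
    then show ?thesis using funcset_mem[OF assms(1)] by simp
  next
    case 2
    then show ?thesis using funcset_mem[OF assms(1)] by simp
  qed
qed

lemma word_eval_closed:
  assumes "f \<in> X \<rightarrow> carrier G" "w \<in> words X"
  shows "word_eval G f w \<in> carrier G"
  using assms(2)
proof (induction w)
  case (Cons a w)
  then have "letter_eval G f a \<in> carrier G" "w \<in> words X"
    using letter_eval_closed[OF assms(1)] by (auto simp: words_def)
  with Cons.IH show ?case by simp
qed simp

lemma word_eval_append:
  assumes "f \<in> X \<rightarrow> carrier G" "u \<in> words X" "v \<in> words X"
  shows "word_eval G f (u @ v) = word_eval G f u \<otimes> word_eval G f v"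
  using assms(2)
proof (induction u)
  case Nil
  then show ?case using word_eval_closed[OF assms(1,3)] by simp
next
  case (Cons a u)
  then have "letter_eval G f a \<in> carrier G" "u \<in> words X"
    using letter_eval_closed[OF assms(1)] by (auto simp: words_def)
  with Cons.IH show ?case
    using word_eval_closed[OF assms(1)] assms(3) by (simp add: m_assoc)
qed

text \<open>Rule induction: evaluation is multiplicative, which settles \<open>append\<close>; the
  inverse laws settle the two cancellations; the relators are respected by hypothesis.\<close>

lemma word_eval_presentation_rel:
  assumes f: "f \<in> X \<rightarrow> carrier G"
    and R: "\<And>u v. (u, v) \<in> R \<Longrightarrow> u \<in> words X \<Longrightarrow> v \<in> words X \<Longrightarrow> word_eval G f u = word_eval G f v"
    and "(u, v) \<in> presentation_rel X R"
  shows "word_eval G f u = word_eval G f v"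
  using assms(3)
proof (induction rule: presentation_rel.induct)
  case (append u u' v v')
  \<comment> \<open>Multiplicativity of evaluation holds only for words over \<open>X\<close>;
    membership comes from the relation being contained in
    \<open>words X \<times> words X\<close>.\<close>
  then have "u \<in> words X" "u' \<in> words X" "v \<in> words X" "v' \<in> words X"
    using equiv_type[OF equiv_presentation_rel, of X R] by blast+
  with append show ?case by (simp add: word_eval_append[OF f])
next
  case (cancel_right x)
  then have "f x \<in> carrier G" using f by blast
  then show ?case by simp
next
  case (cancel_left x)
  then have "f x \<in> carrier G" using f by blast
  then show ?case by simp
qed (simp_all add: R)

text \<open>Von Dyck's theorem: evaluation of words is constant on classes and so descends to the
  presented group.\<close>

lemma presented_group_universal:
  assumes f: "f \<in> X \<rightarrow> carrier G"
    and R: "\<And>u v. (u, v) \<in> R \<Longrightarrow> u \<in> words X \<Longrightarrow> v \<in> words X \<Longrightarrow> word_eval G f u = word_eval G f v"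
  obtains h where "h \<in> hom (presented_group X R) G"
    "\<And>x. x \<in> X \<Longrightarrow> h (presentation_rel X R `` {[Gen x]}) = f x"
proof -
  let ?c = "\<lambda>w. presentation_rel X R `` {w}"
  \<comment> \<open>The image of a class under evaluation is a singleton, whose element is the value
    of \<open>h\<close>.\<close>
  define h where "h A = the_elem (word_eval G f ` A)" for A
  have carr: "carrier (presented_group X R) = ?c ` words X"
    by (auto simp: presented_group_def quotient_def)
  have h: "h (?c w) = word_eval G f w" if "w \<in> words X" for w
  proof -
    have "w \<in> ?c w" using that by (auto intro: presentation_rel.refl)
    moreover have "word_eval G f v = word_eval G f w" if "v \<in> ?c w" for v
      using word_eval_presentation_rel[OF f R, where u = w and v = v] that by auto
    ultimately have "word_eval G f ` ?c w = {word_eval G f w}" by blast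
    then show ?thesis by (simp add: h_def)
  qed
  show thesis
  proof (rule that[of h])
    show "h \<in> hom (presented_group X R) G"
      by (rule homI)
        (auto simp: carr h mult_presented_group words_append word_eval_append[OF f]
          word_eval_closed[OF f])
    show "h (?c [Gen x]) = f x" if x: "x \<in> X" for x
    proof -
      have "[Gen x] \<in> words X" "f x \<in> carrier G" using x f by (auto simp: words_def)
      then show ?thesis by (simp add: h)
    qed
  qed
qed

end

text \<open>Turns the formal letter \<open>Gen_inv x\<close> in a word, in particular in the quandle
  relators, into an inverse in the group.\<close>

lemma presented_group_inv_generator:
  assumes "x \<in> X"
  shows "presentation_rel X R `` {[Gen_inv x]} =
    inv\<^bsub>presented_group X R\<^esub> (presentation_rel X R `` {[Gen x]})"
proof (rule group.inv_equality[OF group_presented_group, symmetric])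
  let ?G = "presented_group X R" and ?c = "\<lambda>w. presentation_rel X R `` {w}"
  have w: "[Gen x] \<in> words X" "[Gen_inv x] \<in> words X" using assms by (auto simp: words_def)
  then show "?c [Gen x] \<in> carrier ?G" "?c [Gen_inv x] \<in> carrier ?G"
    by (auto simp: presented_group_def quotient_def)
  have "?c [Gen_inv x, Gen x] = ?c []"
    using assms
    by (intro equiv_class_eq[OF equiv_presentation_rel] presentation_rel.cancel_left)
  then show "?c [Gen_inv x] \<otimes>\<^bsub>?G\<^esub> ?c [Gen x] = \<one>\<^bsub>?G\<^esub>"
    using w by (simp add: mult_presented_group) (simp add: presented_group_def)
qed

text \<open>Induction on the word, splitting off one letter at a time. It allows centrality and
  surjectivity to be tested on generators.\<close>

lemma presented_group_generated:
  "generate (presented_group X R) ((\<lambda>x. presentation_rel X R `` {[Gen x]}) ` X) =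
    carrier (presented_group X R)"
proof -
  let ?G = "presented_group X R" and ?c = "\<lambda>w. presentation_rel X R `` {w}"
  let ?E = "(\<lambda>x. ?c [Gen x]) ` X"
  interpret group ?G by (rule group_presented_group)
  have carr: "carrier ?G = ?c ` words X"
    by (auto simp: presented_group_def quotient_def)
  have E: "?E \<subseteq> carrier ?G" by (auto simp: carr words_def)
  have one: "\<one>\<^bsub>?G\<^esub> = ?c []" by (simp add: presented_group_def)
  have "?c w \<in> generate ?G ?E" if "w \<in> words X" for w
    using that
  proof (induction w)
    case Nil
    show ?case unfolding one[symmetric] by (rule generate.one)
  next
    case (Cons a w)
    then have a: "[a] \<in> words X" and w: "w \<in> words X" by (auto simp: words_def)
    have "?c [a] \<in> generate ?G ?E"
      using a generate.incl[of _ ?E ?G] generate.inv[of _ ?E ?G]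
      by (auto simp: words_def presented_group_inv_generator)
    moreover have "?c (a # w) = ?c [a] \<otimes>\<^bsub>?G\<^esub> ?c w"
      using a w by (simp add: mult_presented_group)
    ultimately show ?case using Cons.IH[OF w] by (simp add: generate.eng)
  qed
  then show ?thesis using generate_incl[OF E] by (auto simp: carr)
qed


section \<open>Universal property of \<open>S(M, T)\<close>\<close>

text \<open>The projection onto the quotient by \<open>E\<close> agrees with the trivial homomorphism on pure tensors.\<close>

lemma subgroup_pure_tensors_eq_carrier:
  assumes M: "comm_group M" and N: "comm_group N"
    and E: "subgroup E (tensor_product M N)"
    and pure: "\<And>x y. x \<in> carrier M \<Longrightarrow> y \<in> carrier N \<Longrightarrow> pure_tensor M N x y \<in> E"
  shows "E = carrier (tensor_product M N)"
proof -
  let ?P = "tensor_product M N"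
  interpret P: comm_group ?P by (rule comm_group_tensor_product[OF M N])
  let ?p = "\<lambda>a. E #>\<^bsub>?P\<^esub> a"
  have n: "E \<lhd> ?P" by (rule P.subgroup_imp_normal[OF E])
  interpret Q: comm_group "?P Mod E" by (rule P.abelian_FactGroup[OF E])
  have p: "?p \<in> hom ?P (?P Mod E)" by (rule normal.r_coset_hom_Mod[OF n])
  have q: "(\<lambda>a. \<one>\<^bsub>?P Mod E\<^esub>) \<in> hom ?P (?P Mod E)"
    by (rule homI) (simp_all only: Q.one_closed Q.l_one)
  have "t \<in> E" if t: "t \<in> carrier ?P" for t
  proof -
    have "?p t = \<one>\<^bsub>?P Mod E\<^esub>"
    proof (rule tensor_product_hom_eqI[OF M N Q.comm_group_axioms p q _ t])
      show "?p (pure_tensor M N x y) = \<one>\<^bsub>?P Mod E\<^esub>"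
        if "x \<in> carrier M" "y \<in> carrier N" for x y
        using P.coset_join2[OF _ E pure[OF that]] pure_tensor_closed[OF M N that] by simp
    qed
    then show ?thesis using P.rcos_self[OF t E] by simp
  qed
  then show ?thesis using subgroup.subset[OF E] by blast
qed

context
  fixes M :: "('a, 'b) monoid_scheme" and T :: "'a \<Rightarrow> 'a"
  assumes M: "comm_group M" and T: "T \<in> auto M"
begin

lemma S_proj_hom:
  "(\<lambda>a. im_one_minus_tau M T #>\<^bsub>tensor_product M M\<^esub> a) \<in> hom (tensor_product M M) (S_group M T)"
  unfolding S_group_def
  by (intro normal.r_coset_hom_Mod comm_group.subgroup_imp_normal comm_group_tensor_product
      subgroup_im_one_minus_tau M T)

text \<open>The preimage of \<open>E\<close> in the tensor square is a subgroup with all pure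
  tensors, hence everything, and the projection is onto.\<close>

lemma subgroup_S_class_eq_carrier:
  assumes E: "subgroup E (S_group M T)"
    and pure: "\<And>x y. x \<in> carrier M \<Longrightarrow> y \<in> carrier M \<Longrightarrow> S_class M T x y \<in> E"
  shows "E = carrier (S_group M T)"
proof -
  let ?P = "tensor_product M M" and ?p = "\<lambda>a. im_one_minus_tau M T #>\<^bsub>tensor_product M M\<^esub> a"
  interpret P: comm_group ?P by (rule comm_group_tensor_product[OF M M])
  interpret S: comm_group "S_group M T" by (rule comm_group_S_group[OF M T])
  interpret p: group_hom ?P "S_group M T" ?p
    by (simp add: group_hom_def group_hom_axioms_def S_proj_hom S.is_group)
  have "{a \<in> carrier ?P. ?p a \<in> E} = carrier ?P"
  proof (rule subgroup_pure_tensors_eq_carrier[OF M M])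
    show "subgroup {a \<in> carrier ?P. ?p a \<in> E} ?P"
      using subgroup.m_closed[OF E] subgroup.m_inv_closed[OF E] subgroup.one_closed[OF E]
      by (intro P.subgroupI) (auto intro!: exI[of _ "\<one>\<^bsub>?P\<^esub>"])
    show "pure_tensor M M x y \<in> {a \<in> carrier ?P. ?p a \<in> E}"
      if "x \<in> carrier M" "y \<in> carrier M" for x y
      using pure[OF that] pure_tensor_closed[OF M M that] by (simp add: S_class_def)
  qed
  then have "?p a \<in> E" if "a \<in> carrier ?P" for a using that by blast
  then have "?p ` carrier ?P \<subseteq> E" by (rule image_subsetI)
  then have "carrier (S_group M T) \<subseteq> E"
    by (simp add: S_group_def carrier_FactGroup)
  then show ?thesis using subgroup.subset[OF E] by (rule subset_antisym[rotated])
qed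

text \<open>The equalizer of \<open>h\<close> and \<open>h'\<close> is a subgroup containing the
  classes of pure tensors. The codomain is any group, because the lemma is applied to maps into F(M,
  T), whereas \<open>tensor_product_hom_eqI\<close> asks for an abelian codomain.\<close>

lemma S_group_hom_eqI:
  assumes H: "group H" and h: "h \<in> hom (S_group M T) H" "h' \<in> hom (S_group M T) H"
    and eq: "\<And>x y. x \<in> carrier M \<Longrightarrow> y \<in> carrier M \<Longrightarrow> h (S_class M T x y) = h' (S_class M T x y)"
    and s: "s \<in> carrier (S_group M T)"
  shows "h s = h' s"
proof -
  interpret S: comm_group "S_group M T" by (rule comm_group_S_group[OF M T])
  interpret h: group_hom "S_group M T" H h
    by (simp add: group_hom_def group_hom_axioms_def h S.is_group H)
  interpret h': group_hom "S_group M T" H h'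
    by (simp add: group_hom_def group_hom_axioms_def h S.is_group H)
  have "{a \<in> carrier (S_group M T). h a = h' a} = carrier (S_group M T)"
  proof (rule subgroup_S_class_eq_carrier)
    show "subgroup {a \<in> carrier (S_group M T). h a = h' a} (S_group M T)"
      by (intro S.subgroupI) (auto intro!: exI[of _ "\<one>\<^bsub>S_group M T\<^esub>"])
  qed (simp add: eq S_class_closed[OF M T])
  with s show ?thesis by blast
qed

text \<open>The biadditive \<open>f\<close> induces \<open>g\<close> on the tensor square;
  \<open>swap\<close> says that \<open>g\<close> is invariant under \<open>tau\<close>, so
  \<open>g\<close> kills the image of 1 - tau and factors through the cokernel.\<close>

lemma S_group_universal:
  assumes C: "comm_group C"
    and closed: "\<And>x y. x \<in> carrier M \<Longrightarrow> y \<in> carrier M \<Longrightarrow> f x y \<in> carrier C"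
    and left: "\<And>x x' y. x \<in> carrier M \<Longrightarrow> x' \<in> carrier M \<Longrightarrow> y \<in> carrier M \<Longrightarrow>
      f (x \<otimes>\<^bsub>M\<^esub> x') y = f x y \<otimes>\<^bsub>C\<^esub> f x' y"
    and right: "\<And>x y y'. x \<in> carrier M \<Longrightarrow> y \<in> carrier M \<Longrightarrow> y' \<in> carrier M \<Longrightarrow>
      f x (y \<otimes>\<^bsub>M\<^esub> y') = f x y \<otimes>\<^bsub>C\<^esub> f x y'"
    and swap: "\<And>x y. x \<in> carrier M \<Longrightarrow> y \<in> carrier M \<Longrightarrow> f (T y) x = f x y"
  obtains h where "h \<in> hom (S_group M T) C"
    "\<And>x y. x \<in> carrier M \<Longrightarrow> y \<in> carrier M \<Longrightarrow> h (S_class M T x y) = f x y"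
proof -
  let ?P = "tensor_product M M"
  interpret C: comm_group C by fact
  interpret P: comm_group ?P by (rule comm_group_tensor_product[OF M M])
  obtain g where g: "g \<in> hom ?P C"
    "\<And>x y. x \<in> carrier M \<Longrightarrow> y \<in> carrier M \<Longrightarrow> g (pure_tensor M M x y) = f x y"
    by (rule tensor_product_universal[OF M M C, of f]) (use closed left right in auto)
  interpret g: group_hom ?P C g
    by (simp add: group_hom_def group_hom_axioms_def g(1) C.is_group)
  note tau = tau_hom[OF M T]
  have g_tau: "g (tau M T t) = g t" if "t \<in> carrier ?P" for t
  proof -
    have "(g \<circ> tau M T) t = g t"
      by (rule tensor_product_hom_eqI[OF M M C hom_compose[OF tau g(1)] g(1) _ that])
        (simp add: tau_pure_tensor[OF M T] g(2) auto_carrier[OF T] swap)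
    then show ?thesis by simp
  qed
  have "im_one_minus_tau M T \<subseteq> kernel ?P C g"
    unfolding im_one_minus_tau_def one_minus_def kernel_def
    using hom_in_carrier[OF tau] by (auto simp: g_tau)
  moreover have "im_one_minus_tau M T \<lhd> ?P"
    by (intro P.subgroup_imp_normal subgroup_im_one_minus_tau M T)
  ultimately obtain h where "h \<in> hom (S_group M T) C"
    "\<And>a. a \<in> carrier ?P \<Longrightarrow> h (im_one_minus_tau M T #>\<^bsub>?P\<^esub> a) = g a"
    unfolding S_group_def using g.FactGroup_universal_kernel by metis
  with that[of h] show ?thesis
    by (simp add: S_class_def g(2) pure_tensor_closed[OF M M])
qed

end


section \<open>The centre of a group\<close>

definition centre :: "('a, 'b) monoid_scheme \<Rightarrow> 'a set"
  where "centre G = {z \<in> carrier G. \<forall>w\<in>carrier G. z \<otimes>\<^bsub>G\<^esub> w = w \<otimes>\<^bsub>G\<^esub> z}"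

context group
begin

lemma centre_closed: "z \<in> centre G \<Longrightarrow> z \<in> carrier G"
  by (simp add: centre_def)

lemma centre_comm: "z \<in> centre G \<Longrightarrow> w \<in> carrier G \<Longrightarrow> z \<otimes> w = w \<otimes> z"
  by (simp add: centre_def)

lemma commute_inv:
  assumes "z \<in> carrier G" "w \<in> carrier G" "z \<otimes> w = w \<otimes> z"
  shows "z \<otimes> inv w = inv w \<otimes> z"
proof -
  have "w \<otimes> (z \<otimes> inv w) = z"
    unfolding m_assoc[OF assms(2,1) inv_closed[OF assms(2)], symmetric] assms(3)[symmetric]
    using assms(1,2) by (simp add: m_assoc)
  then show ?thesis using inv_solve_left[of "z \<otimes> inv w" w z] assms(1,2) by simp
qed

lemma subgroup_commuting:
  assumes "z \<in> carrier G"
  shows "subgroup {w \<in> carrier G. z \<otimes> w = w \<otimes> z} G"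
proof (rule subgroupI)
  show "a \<otimes> b \<in> {w \<in> carrier G. z \<otimes> w = w \<otimes> z}"
    if "a \<in> {w \<in> carrier G. z \<otimes> w = w \<otimes> z}" "b \<in> {w \<in> carrier G. z \<otimes> w = w \<otimes> z}" for a b
  proof -
    have "z \<otimes> (a \<otimes> b) = z \<otimes> a \<otimes> b" by (rule m_assoc[symmetric]) (use that assms in auto)
    also have "\<dots> = a \<otimes> z \<otimes> b" using that by simp
    also have "\<dots> = a \<otimes> (z \<otimes> b)" by (rule m_assoc) (use that assms in auto)
    also have "\<dots> = a \<otimes> b \<otimes> z" using that assms by (simp add: m_assoc)
    finally show ?thesis using that by blast
  qed
  show "inv a \<in> {w \<in> carrier G. z \<otimes> w = w \<otimes> z}" if "a \<in> {w \<in> carrier G. z \<otimes> w = w \<otimes> z}" for a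
    using that commute_inv[OF assms, of a] by blast
  have "\<one> \<in> {w \<in> carrier G. z \<otimes> w = w \<otimes> z}" using assms by simp
  then show "{w \<in> carrier G. z \<otimes> w = w \<otimes> z} \<noteq> {}" by blast
qed blast

lemma subgroup_centre: "subgroup (centre G) G"
proof (rule subgroupI)
  show "a \<otimes> b \<in> centre G" if "a \<in> centre G" "b \<in> centre G" for a b
  proof -
    have "a \<otimes> b \<otimes> w = w \<otimes> (a \<otimes> b)" if "w \<in> carrier G" for w
      using \<open>a \<in> centre G\<close> \<open>b \<in> centre G\<close> that centre_closed
      by (metis centre_comm m_assoc)
    moreover have "a \<otimes> b \<in> carrier G" using that centre_closed by simp
    ultimately show ?thesis unfolding centre_def by blast
  qed
  show "inv a \<in> centre G" if "a \<in> centre G" for a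
  proof -
    have "inv a \<otimes> w = w \<otimes> inv a" if "w \<in> carrier G" for w
      using commute_inv[of w a] \<open>a \<in> centre G\<close> that centre_closed centre_comm by metis
    moreover have "inv a \<in> carrier G" using that centre_closed by simp
    ultimately show ?thesis unfolding centre_def by blast
  qed
  have "\<one> \<in> centre G" by (simp add: centre_def)
  then show "centre G \<noteq> {}" by blast
qed (use centre_closed in blast)

text \<open>Provides the abelian codomain that \<open>S_group_universal\<close> asks for, inside a
  group that may be nonabelian.\<close>

lemma comm_group_centre: "comm_group (G\<lparr>carrier := centre G\<rparr>)"
  by (rule group.group_comm_groupI[OF subgroup_imp_group[OF subgroup_centre]])
    (simp, rule centre_comm, auto intro: centre_closed)

text \<open>The centralizer of \<open>z\<close> is a subgroup, so it is the whole group once it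
  contains a generating set.\<close>

lemma centreI_generate:
  assumes "generate G A = carrier G" "A \<subseteq> carrier G" "z \<in> carrier G"
    and "\<And>a. a \<in> A \<Longrightarrow> z \<otimes> a = a \<otimes> z"
  shows "z \<in> centre G"
proof -
  have "A \<subseteq> {w \<in> carrier G. z \<otimes> w = w \<otimes> z}" using assms by blast
  then have "generate G A \<subseteq> {w \<in> carrier G. z \<otimes> w = w \<otimes> z}"
    by (rule generate_subgroup_incl) (rule subgroup_commuting[OF assms(3)])
  with assms(1,3) show ?thesis unfolding centre_def by blast
qed

end

section \<open>Representations of the Alexander quandle in a group\<close>

text \<open>Isolates what the argument uses of the adjoint group: its generators \<open>e x\<close>
  and their relations. \<open>e_commute\<close> is the quandle relation multiplied by
  \<open>e x\<close>, with Ty + x - Tx regrouped as Ty + (1 - T)x.\<close>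

locale alexander_representation = group G + M: comm_group M
  for G (structure) and M :: "('m, 'n) monoid_scheme" +
  fixes T :: "'m \<Rightarrow> 'm" and e
  assumes T: "T \<in> auto M" and one_minus_T: "one_minus M T \<in> auto M"
    and e_closed [simp]: "x \<in> carrier M \<Longrightarrow> e x \<in> carrier G"
    and e_commute: "x \<in> carrier M \<Longrightarrow> y \<in> carrier M \<Longrightarrow>
      e y \<otimes> e x = e x \<otimes> e (T y \<otimes>\<^bsub>M\<^esub> one_minus M T x)"
    and generate_e: "generate G (e ` carrier M) = carrier G"
begin

abbreviation D where "D \<equiv> one_minus M T"

definition g where "g x = inv (e \<one>\<^bsub>M\<^esub>) \<otimes> e x"

text \<open>The factor set of \<open>g\<close>, measuring its failure to be a homomorphism.\<close>

definition lam where "lam x y = g x \<otimes> g y \<otimes> inv (g (x \<otimes>\<^bsub>M\<^esub> y))"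

lemma T_closed [simp]: "x \<in> carrier M \<Longrightarrow> T x \<in> carrier M"
  and D_closed [simp]: "x \<in> carrier M \<Longrightarrow> D x \<in> carrier M"
  and D_mult: "x \<in> carrier M \<Longrightarrow> y \<in> carrier M \<Longrightarrow> D (x \<otimes>\<^bsub>M\<^esub> y) = D x \<otimes>\<^bsub>M\<^esub> D y"
  using auto_carrier[OF T] auto_carrier[OF one_minus_T] auto_mult[OF one_minus_T] by blast+

lemma D_one: "D \<one>\<^bsub>M\<^esub> = \<one>\<^bsub>M\<^esub>"
  using one_minus_T by (simp add: auto_def hom_one M.is_group)

lemma T_surj:
  assumes "y \<in> carrier M"
  obtains x where "x \<in> carrier M" "y = T x"
  using T assms by (auto simp: auto_def Bij_def bij_betw_def)

lemma D_surj:
  assumes "y \<in> carrier M"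
  obtains x where "x \<in> carrier M" "y = D x"
  using one_minus_T assms unfolding auto_def Bij_def bij_betw_def by blast

lemma g_closed [simp]: "x \<in> carrier M \<Longrightarrow> g x \<in> carrier G"
  by (simp add: g_def)

lemma e_one_g: "x \<in> carrier M \<Longrightarrow> e \<one>\<^bsub>M\<^esub> \<otimes> g x = e x"
  by (simp add: g_def flip: m_assoc)

lemma e_commute_one: "y \<in> carrier M \<Longrightarrow> e y \<otimes> e \<one>\<^bsub>M\<^esub> = e \<one>\<^bsub>M\<^esub> \<otimes> e (T y)"
  using e_commute[of "\<one>\<^bsub>M\<^esub>" y] by (simp add: D_one)

lemma g_commute_one:
  assumes "x \<in> carrier M"
  shows "g x \<otimes> e \<one>\<^bsub>M\<^esub> = e \<one>\<^bsub>M\<^esub> \<otimes> g (T x)"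
proof -
  have "g x \<otimes> e \<one>\<^bsub>M\<^esub> = inv (e \<one>\<^bsub>M\<^esub>) \<otimes> (e \<one>\<^bsub>M\<^esub> \<otimes> e (T x))"
    using assms e_commute_one by (simp add: g_def m_assoc)
  also have "\<dots> = e \<one>\<^bsub>M\<^esub> \<otimes> g (T x)"
    using assms by (simp add: g_def flip: m_assoc)
  finally show ?thesis .
qed

lemma e_g:
  assumes "z \<in> carrier M" "x \<in> carrier M"
  shows "e z \<otimes> g x = g x \<otimes> e (z \<otimes>\<^bsub>M\<^esub> D x)"
proof -
  obtain w where w: "w \<in> carrier M" "z = T w" using T_surj assms(1) by metis
  have "e z = inv (e \<one>\<^bsub>M\<^esub>) \<otimes> (e w \<otimes> e \<one>\<^bsub>M\<^esub>)"
    using w by (simp add: inv_solve_left e_commute_one)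
  then have "e z \<otimes> g x = inv (e \<one>\<^bsub>M\<^esub>) \<otimes> (e w \<otimes> (e \<one>\<^bsub>M\<^esub> \<otimes> g x))"
    using w assms by (simp add: m_assoc)
  also have "\<dots> = inv (e \<one>\<^bsub>M\<^esub>) \<otimes> (e x \<otimes> e (T w \<otimes>\<^bsub>M\<^esub> D x))"
    using w assms e_commute[of x w] by (simp add: e_one_g)
  also have "\<dots> = g x \<otimes> e (z \<otimes>\<^bsub>M\<^esub> D x)"
    using w assms by (simp add: g_def m_assoc)
  finally show ?thesis .
qed

lemma lam_closed: "x \<in> carrier M \<Longrightarrow> y \<in> carrier M \<Longrightarrow> lam x y \<in> carrier G"
  by (simp add: lam_def)

lemma g_mult: "x \<in> carrier M \<Longrightarrow> y \<in> carrier M \<Longrightarrow> g x \<otimes> g y = lam x y \<otimes> g (x \<otimes>\<^bsub>M\<^esub> y)"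
  by (simp add: lam_def m_assoc)

text \<open>Both \<open>g x \<otimes> g y\<close> and \<open>g (x \<otimes> y)\<close> act on the generators by the same translation.\<close>

lemma lam_centre:
  assumes x: "x \<in> carrier M" and y: "y \<in> carrier M"
  shows "lam x y \<in> centre G"
proof (rule centreI_generate[OF generate_e])
  let ?xy = "x \<otimes>\<^bsub>M\<^esub> y"
  show "e ` carrier M \<subseteq> carrier G" by auto
  show l: "lam x y \<in> carrier G" by (rule lam_closed[OF x y])
  show "lam x y \<otimes> a = a \<otimes> lam x y" if a_in: "a \<in> e ` carrier M" for a
  proof -
    obtain z where a: "a = e z" and z: "z \<in> carrier M" using a_in by blast
    \<comment> \<open>\<open>b\<close> is the conjugate of \<open>e z\<close>: fact \<open>1\<close>
      finds it by translating by Dx and then Dy, fact \<open>2\<close> by translating by D(x + y) at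
      once.\<close>
    define b where "b = e (z \<otimes>\<^bsub>M\<^esub> D ?xy)"
    have b: "b \<in> carrier G" using x y z by (simp add: b_def)
    have "e z \<otimes> (g x \<otimes> g y) = e z \<otimes> g x \<otimes> g y" using x y z by (simp add: m_assoc)
    also have "\<dots> = g x \<otimes> (e (z \<otimes>\<^bsub>M\<^esub> D x) \<otimes> g y)" using x y z by (simp add: e_g m_assoc)
    also have "\<dots> = g x \<otimes> (g y \<otimes> b)"
      using x y z by (simp add: e_g D_mult M.m_assoc b_def)
    finally have 1: "e z \<otimes> (g x \<otimes> g y) = g x \<otimes> g y \<otimes> b" using x y b by (simp add: m_assoc)
    have 2: "b \<otimes> inv g ?xy = inv g ?xy \<otimes> e z"
    proof -
      have "b = inv g ?xy \<otimes> (e z \<otimes> g ?xy)"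
        using x y z by (simp add: b_def e_g inv_solve_left)
      then show ?thesis using x y z by (simp add: m_assoc)
    qed
    have "e z \<otimes> lam x y = e z \<otimes> (g x \<otimes> g y) \<otimes> inv g ?xy"
      using x y z by (simp add: lam_def m_assoc)
    also have "\<dots> = g x \<otimes> g y \<otimes> (b \<otimes> inv g ?xy)"
      unfolding 1 using x y b by (simp add: m_assoc)
    also have "\<dots> = lam x y \<otimes> e z"
      unfolding 2 using x y z by (simp add: lam_def m_assoc)
    finally show ?thesis by (simp add: a)
  qed
qed

section \<open>Commutators of the \<open>g x\<close>; biadditivity and symmetry of
  \<open>lam\<close>\<close>

lemma lam_left_comm:
  assumes "x \<in> carrier M" "y \<in> carrier M" "a \<in> carrier G" "b \<in> carrier G"
  shows "a \<otimes> (lam x y \<otimes> b) = lam x y \<otimes> (a \<otimes> b)"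
  using assms lam_closed centre_comm[OF lam_centre] by (metis m_assoc)

text \<open>As rewrite rules these collect the central factors on the left, whereas the general rule
  could exchange two factors \<open>lam\<close> forever.\<close>

lemma lam_left_comm_g:
  assumes "x \<in> carrier M" "y \<in> carrier M" "z \<in> carrier M" "b \<in> carrier G"
  shows "g z \<otimes> (lam x y \<otimes> b) = lam x y \<otimes> (g z \<otimes> b)"
    and "inv g z \<otimes> (lam x y \<otimes> b) = lam x y \<otimes> (inv g z \<otimes> b)"
  using assms by (simp_all add: lam_left_comm)

lemma g_commute:
  assumes x: "x \<in> carrier M" and y: "y \<in> carrier M"
  shows "g y \<otimes> g x = lam (D y) x \<otimes> (g x \<otimes> g y)"
proof -
  have "g y \<otimes> e \<one>\<^bsub>M\<^esub> \<otimes> g (D y) = e \<one>\<^bsub>M\<^esub> \<otimes> g y"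
    using e_g[of "\<one>\<^bsub>M\<^esub>" y] x y by (simp add: m_assoc e_one_g)
  then have 1: "g y \<otimes> e \<one>\<^bsub>M\<^esub> = e \<one>\<^bsub>M\<^esub> \<otimes> g y \<otimes> inv g (D y)"
    using y by (simp add: inv_solve_right)
  have "e \<one>\<^bsub>M\<^esub> \<otimes> (g x \<otimes> g y) = e x \<otimes> g y"
    using x y e_one_g[OF x] by (simp flip: m_assoc[of "e \<one>\<^bsub>M\<^esub>" "g x" "g y"])
  also have "\<dots> = g y \<otimes> e \<one>\<^bsub>M\<^esub> \<otimes> g (D y \<otimes>\<^bsub>M\<^esub> x)"
    using x y e_g[OF x y] by (simp add: m_assoc e_one_g M.m_comm)
  also have "\<dots> = e \<one>\<^bsub>M\<^esub> \<otimes> (g y \<otimes> (inv g (D y) \<otimes> g (D y \<otimes>\<^bsub>M\<^esub> x)))"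
    unfolding 1 using x y by (simp add: m_assoc)
  finally have "g x \<otimes> g y = g y \<otimes> (inv g (D y) \<otimes> g (D y \<otimes>\<^bsub>M\<^esub> x))"
    using x y by simp
  \<comment> \<open>The central factor turns g(Dy + x) into the product of g(Dy) and g(x), after
    which g(Dy) cancels.\<close>
  then have "lam (D y) x \<otimes> (g x \<otimes> g y) = g y \<otimes> (inv g (D y) \<otimes> (lam (D y) x \<otimes> g (D y \<otimes>\<^bsub>M\<^esub> x)))"
    using x y by (simp add: lam_left_comm_g)
  also have "\<dots> = g y \<otimes> (inv g (D y) \<otimes> (g (D y) \<otimes> g x))"
    using x y by (simp add: g_mult)
  also have "\<dots> = g y \<otimes> g x"
    using x y by (simp flip: m_assoc[of "inv g (D y)"])
  finally show ?thesis by simp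
qed

text \<open>By \<open>g_commute\<close>, \<open>lam (D y) x\<close> is a commutator of elements that commute up to central
  elements, hence bimultiplicative in \<open>x\<close> and \<open>y\<close>.\<close>

lemma lam_D_mult:
  assumes x: "x \<in> carrier M" and x': "x' \<in> carrier M" and y: "y \<in> carrier M"
  shows "lam (D y) (x \<otimes>\<^bsub>M\<^esub> x') = lam (D y) x \<otimes> lam (D y) x'"
proof -
  \<comment> \<open>Both sides of the claim, multiplied by
    \<open>g x \<otimes> g x' \<otimes> g y\<close>, give the product of \<open>g y\<close>,
    \<open>g x\<close>, \<open>g x'\<close>: \<open>g y\<close> is moved past g(x + x') at once, or
    past the two factors in turn.\<close>
  have "lam (D y) (x \<otimes>\<^bsub>M\<^esub> x') \<otimes> (g x \<otimes> g x' \<otimes> g y) =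
      lam x x' \<otimes> (lam (D y) (x \<otimes>\<^bsub>M\<^esub> x') \<otimes> (g (x \<otimes>\<^bsub>M\<^esub> x') \<otimes> g y))"
    using x x' y lam_left_comm[of x x' "lam (D y) (x \<otimes>\<^bsub>M\<^esub> x')"]
    by (simp add: g_mult lam_closed m_assoc)
  also have "\<dots> = lam x x' \<otimes> (g y \<otimes> g (x \<otimes>\<^bsub>M\<^esub> x'))"
    using x x' y by (simp add: g_commute[symmetric])
  also have "\<dots> = g y \<otimes> (g x \<otimes> g x')"
    using x x' y by (simp add: g_mult lam_left_comm_g)
  also have "\<dots> = g y \<otimes> g x \<otimes> g x'"
    using x x' y by (simp add: m_assoc)
  also have "\<dots> = lam (D y) x \<otimes> (g x \<otimes> (g y \<otimes> g x'))"
    unfolding g_commute[OF x y] using x x' y by (simp add: lam_closed m_assoc)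
  also have "\<dots> = lam (D y) x \<otimes> lam (D y) x' \<otimes> (g x \<otimes> g x' \<otimes> g y)"
    unfolding g_commute[OF x' y] using x x' y by (simp add: lam_left_comm_g lam_closed m_assoc)
  finally show ?thesis using x x' y by (simp add: lam_closed)
qed

text \<open>The same comparison, now moving \<open>g x\<close> past
  \<open>g y \<otimes> g y'\<close>, either as one factor g(y + y') or one factor at a time.\<close>

lemma lam_mult_D:
  assumes x: "x \<in> carrier M" and y: "y \<in> carrier M" and y': "y' \<in> carrier M"
  shows "lam (D y \<otimes>\<^bsub>M\<^esub> D y') x = lam (D y) x \<otimes> lam (D y') x"
proof -
  have "lam (D (y \<otimes>\<^bsub>M\<^esub> y')) x \<otimes> (g x \<otimes> (g y \<otimes> g y')) =
      lam y y' \<otimes> (lam (D (y \<otimes>\<^bsub>M\<^esub> y')) x \<otimes> (g x \<otimes> g (y \<otimes>\<^bsub>M\<^esub> y')))"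
    using x y y' lam_left_comm[of y y' "lam (D (y \<otimes>\<^bsub>M\<^esub> y')) x"]
    by (simp add: g_mult lam_left_comm_g lam_closed)
  also have "\<dots> = lam y y' \<otimes> (g (y \<otimes>\<^bsub>M\<^esub> y') \<otimes> g x)"
    using x y y' by (simp add: g_commute[symmetric])
  also have "\<dots> = g y \<otimes> g y' \<otimes> g x"
    using x y y' by (simp add: g_mult lam_closed m_assoc)
  also have "\<dots> = g y \<otimes> (g y' \<otimes> g x)"
    using x y y' by (simp add: m_assoc)
  also have "\<dots> = lam (D y') x \<otimes> (g y \<otimes> g x \<otimes> g y')"
    unfolding g_commute[OF x y'] using x y y' by (simp add: lam_left_comm_g m_assoc)
  also have "\<dots> = lam (D y') x \<otimes> lam (D y) x \<otimes> (g x \<otimes> (g y \<otimes> g y'))"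
    unfolding g_commute[OF x y] using x y y' by (simp add: lam_closed m_assoc)
  \<comment> \<open>The factors appear in reverse order because \<open>g x\<close> meets
    \<open>g y'\<close> first; they are central.\<close>
  also have "lam (D y') x \<otimes> lam (D y) x = lam (D y) x \<otimes> lam (D y') x"
    using x y y' by (simp add: centre_comm lam_centre lam_closed)
  finally show ?thesis using x y y' by (simp add: lam_closed D_mult)
qed

text \<open>Surjectivity of 1 - T enters here: every first argument is a value of \<open>D\<close>.
  The same holds for \<open>lam_mult_right\<close>.\<close>

lemma lam_mult_left:
  "x \<in> carrier M \<Longrightarrow> x' \<in> carrier M \<Longrightarrow> y \<in> carrier M \<Longrightarrow>
    lam (x \<otimes>\<^bsub>M\<^esub> x') y = lam x y \<otimes> lam x' y"
  by (metis D_surj lam_mult_D)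

lemma lam_mult_right:
  "x \<in> carrier M \<Longrightarrow> y \<in> carrier M \<Longrightarrow> y' \<in> carrier M \<Longrightarrow>
    lam x (y \<otimes>\<^bsub>M\<^esub> y') = lam x y \<otimes> lam x y'"
  by (metis D_surj lam_D_mult)

text \<open>The commutator formula and additivity along y = Dy + Ty both express
  \<open>lam y x\<close> as \<open>lam (D y) x\<close> times a second factor, \<open>lam x y\<close>
  in one case and \<open>lam (T y) x\<close> in the other.\<close>

lemma lam_swap:
  assumes x: "x \<in> carrier M" and y: "y \<in> carrier M"
  shows "lam (T y) x = lam x y"
proof -
  have "lam (D y) x \<otimes> lam x y \<otimes> g (y \<otimes>\<^bsub>M\<^esub> x) = lam (D y) x \<otimes> (g x \<otimes> g y)"
    using x y by (simp add: g_mult lam_closed m_assoc M.m_comm)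
  also have "\<dots> = lam y x \<otimes> g (y \<otimes>\<^bsub>M\<^esub> x)"
    using g_commute[OF x y] g_mult[OF y x] by simp
  finally have "lam (D y) x \<otimes> lam x y = lam y x"
    using x y by (simp add: lam_closed)
  also have "lam y x = lam (D y \<otimes>\<^bsub>M\<^esub> T y) x"
    using y by (simp add: one_minus_def M.m_assoc)
  also have "\<dots> = lam (D y) x \<otimes> lam (T y) x"
    using x y by (simp add: lam_mult_left)
  finally show ?thesis using x y by (simp add: lam_closed)
qed

end

section \<open>The group \<open>F(M, T)\<close>\<close>

lemma
  assumes "group M" "T \<in> auto M"
  shows auto_int_pow: "T [^]\<^bsub>AutoGroup M\<^esub> (m::int) \<in> auto M"
    and auto_int_pow_0: "x \<in> carrier M \<Longrightarrow> (T [^]\<^bsub>AutoGroup M\<^esub> (0::int)) x = x"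
    and auto_group_one: "x \<in> carrier M \<Longrightarrow> \<one>\<^bsub>AutoGroup M\<^esub> x = x"
    and auto_int_pow_1: "T [^]\<^bsub>AutoGroup M\<^esub> (1::int) = T"
    and auto_int_pow_add: "x \<in> carrier M \<Longrightarrow>
      (T [^]\<^bsub>AutoGroup M\<^esub> (m + n)) x = (T [^]\<^bsub>AutoGroup M\<^esub> m) ((T [^]\<^bsub>AutoGroup M\<^esub> n) x)"
proof -
  interpret M: group M by fact
  interpret A: group "AutoGroup M" by (rule M.AutoGroup)
  have T: "T \<in> carrier (AutoGroup M)" using assms(2) by (simp add: AutoGroup_def)
  have comp: "(f \<otimes>\<^bsub>AutoGroup M\<^esub> g) x = f (g x)"
    if "f \<in> carrier (AutoGroup M)" "g \<in> carrier (AutoGroup M)" "x \<in> carrier M" for f g x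
    using that by (simp add: AutoGroup_def BijGroup_def auto_def compose_def)
  show "T [^]\<^bsub>AutoGroup M\<^esub> m \<in> auto M"
    using A.int_pow_closed[OF T, of m] by (simp add: AutoGroup_def)
  show "(T [^]\<^bsub>AutoGroup M\<^esub> (0::int)) x = x"
    and "\<one>\<^bsub>AutoGroup M\<^esub> x = x" if "x \<in> carrier M"
    using that by (simp_all add: AutoGroup_def BijGroup_def)
  show "T [^]\<^bsub>AutoGroup M\<^esub> (1::int) = T" using T by simp
  show "(T [^]\<^bsub>AutoGroup M\<^esub> (m + n)) x = (T [^]\<^bsub>AutoGroup M\<^esub> m) ((T [^]\<^bsub>AutoGroup M\<^esub> n) x)"
    if "x \<in> carrier M"
    using that T comp by (simp add: A.int_pow_mult)
qed

lemma carrier_F_group: "carrier (F_group M T) = UNIV \<times> carrier M \<times> carrier (S_group M T)"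
  and mult_F_group: "(k, x, \<alpha>) \<otimes>\<^bsub>F_group M T\<^esub> (m, y, \<beta>) =
    (k + m, (T [^]\<^bsub>AutoGroup M\<^esub> m) x \<otimes>\<^bsub>M\<^esub> y,
     \<alpha> \<otimes>\<^bsub>S_group M T\<^esub> \<beta> \<otimes>\<^bsub>S_group M T\<^esub> S_class M T ((T [^]\<^bsub>AutoGroup M\<^esub> m) x) y)"
  by (simp_all add: F_group_def Let_def)

lemma S_class_one:
  assumes M: "comm_group M" and T: "T \<in> auto M" and x: "x \<in> carrier M"
  shows "S_class M T \<one>\<^bsub>M\<^esub> x = \<one>\<^bsub>S_group M T\<^esub>" and "S_class M T x \<one>\<^bsub>M\<^esub> = \<one>\<^bsub>S_group M T\<^esub>"
proof -
  interpret M: comm_group M by fact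
  interpret S: comm_group "S_group M T" by (rule comm_group_S_group[OF M T])
  show "S_class M T \<one>\<^bsub>M\<^esub> x = \<one>\<^bsub>S_group M T\<^esub>"
    using S_class_mult_left[OF M T, of "\<one>\<^bsub>M\<^esub>" "\<one>\<^bsub>M\<^esub>" x] x
    by (metis M.l_one M.one_closed S.l_cancel_one' S_class_closed[OF M T])
  show "S_class M T x \<one>\<^bsub>M\<^esub> = \<one>\<^bsub>S_group M T\<^esub>"
    using S_class_mult_right[OF M T, of x "\<one>\<^bsub>M\<^esub>" "\<one>\<^bsub>M\<^esub>"] x
    by (metis M.l_one M.one_closed S.l_cancel_one' S_class_closed[OF M T])
qed

section \<open>The homomorphism from F(M, T) and its inverse\<close>

context alexander_representation
begin

lemma g_commute_pow:
  assumes "x \<in> carrier M"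
  shows "g x \<otimes> e \<one>\<^bsub>M\<^esub> [^] (m::int) = e \<one>\<^bsub>M\<^esub> [^] m \<otimes> g ((T [^]\<^bsub>AutoGroup M\<^esub> m) x)"
proof -
  let ?T = "\<lambda>m::int. T [^]\<^bsub>AutoGroup M\<^esub> m" and ?e = "e \<one>\<^bsub>M\<^esub>"
  have cl: "?T m x \<in> carrier M" for m
    using auto_carrier[OF auto_int_pow[OF M.is_group T]] assms by simp
  have T_Suc: "?T (i + 1) x = T (?T i x)" for i
    using auto_int_pow_add[OF M.is_group T assms, of 1 i] auto_int_pow_1[OF M.is_group T]
    by (simp add: add.commute)
  have e_Suc: "?e [^] (i + 1) = ?e [^] i \<otimes> ?e" for i :: int
    by (simp add: int_pow_mult)
  \<comment> \<open>Stated as an equivalence to serve the upward and the downward induction over the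
    integers.\<close>
  have step: "g x \<otimes> ?e [^] (i + 1) = ?e [^] (i + 1) \<otimes> g (?T (i + 1) x) \<longleftrightarrow>
      g x \<otimes> ?e [^] i = ?e [^] i \<otimes> g (?T i x)" for i
  proof -
    have "?e [^] (i + 1) \<otimes> g (?T (i + 1) x) = ?e [^] i \<otimes> (g (?T i x) \<otimes> ?e)"
      using cl by (simp add: e_Suc T_Suc m_assoc g_commute_one)
    then have "?e [^] (i + 1) \<otimes> g (?T (i + 1) x) = ?e [^] i \<otimes> g (?T i x) \<otimes> ?e"
      using cl by (simp add: m_assoc)
    moreover have "g x \<otimes> ?e [^] (i + 1) = g x \<otimes> ?e [^] i \<otimes> ?e"
      using assms by (simp add: e_Suc m_assoc)
    ultimately show ?thesis using assms cl by simp
  qed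
  show ?thesis
  proof (induction m rule: int_induct[where k = 0])
    case base
    show ?case unfolding auto_int_pow_0[OF M.is_group T assms] using assms by simp
  next
    case (step1 i)
    then show ?case using step[of i] by simp
  next
    case (step2 i)
    then show ?case using step[of "i - 1"] by simp
  qed
qed

lemma F_group_hom:
  obtains h where "(\<lambda>(k, x, \<alpha>). e \<one>\<^bsub>M\<^esub> [^] k \<otimes> g x \<otimes> h \<alpha>) \<in> hom (F_group M T) G"
    "h \<in> hom (S_group M T) G"
    "\<And>x y. x \<in> carrier M \<Longrightarrow> y \<in> carrier M \<Longrightarrow> h (S_class M T x y) = lam x y"
proof -
  note M = M.comm_group_axioms
  let ?e = "e \<one>\<^bsub>M\<^esub>" and ?S = "S_group M T"
  interpret S: comm_group ?S by (rule comm_group_S_group[OF M T])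
  obtain h where h: "h \<in> hom ?S (G\<lparr>carrier := centre G\<rparr>)"
    and h_class: "\<And>x y. x \<in> carrier M \<Longrightarrow> y \<in> carrier M \<Longrightarrow> h (S_class M T x y) = lam x y"
    by (rule S_group_universal[OF M T comm_group_centre, of lam])
      (simp_all add: lam_centre lam_mult_left lam_mult_right lam_swap)
  have hz: "h \<alpha> \<in> centre G" if "\<alpha> \<in> carrier ?S" for \<alpha>
    using hom_in_carrier[OF h that] by simp
  note hc = centre_closed[OF hz]
  have h_mult: "h (\<alpha> \<otimes>\<^bsub>?S\<^esub> \<beta>) = h \<alpha> \<otimes> h \<beta>" if "\<alpha> \<in> carrier ?S" "\<beta> \<in> carrier ?S" for \<alpha> \<beta>
    using hom_mult[OF h that] by simp
  have "(\<lambda>(k, x, \<alpha>). ?e [^] k \<otimes> g x \<otimes> h \<alpha>) \<in> hom (F_group M T) G"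
  proof (rule homI)
    fix a b assume a: "a \<in> carrier (F_group M T)" and b: "b \<in> carrier (F_group M T)"
    obtain k x \<alpha> m y \<beta> where ab: "a = (k, x, \<alpha>)" "b = (m, y, \<beta>)"
      by (cases a, cases b) auto
    have [simp]: "x \<in> carrier M" "y \<in> carrier M" and s: "\<alpha> \<in> carrier ?S" "\<beta> \<in> carrier ?S"
      using a b by (auto simp: ab carrier_F_group)
    note [simp] = hc[OF s(1)] hc[OF s(2)]
    define x' where "x' = (T [^]\<^bsub>AutoGroup M\<^esub> m) x"
    have x' [simp]: "x' \<in> carrier M"
      using auto_carrier[OF auto_int_pow[OF M.is_group T]] by (simp add: x'_def)
    \<comment> \<open>Regrouped so that the central \<open>h \<alpha>\<close> can pass to the
      right.\<close>
    have "?e [^] k \<otimes> g x \<otimes> h \<alpha> \<otimes> (?e [^] m \<otimes> g y \<otimes> h \<beta>) =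
        ?e [^] k \<otimes> g x \<otimes> (h \<alpha> \<otimes> (?e [^] m \<otimes> g y)) \<otimes> h \<beta>"
      by (simp add: m_assoc)
    also have "\<dots> = ?e [^] k \<otimes> (g x \<otimes> ?e [^] m) \<otimes> g y \<otimes> (h \<alpha> \<otimes> h \<beta>)"
      unfolding centre_comm[OF hz[OF s(1)], of "?e [^] m \<otimes> g y", simplified] by (simp add: m_assoc)
    also have "\<dots> = ?e [^] k \<otimes> ?e [^] m \<otimes> (g x' \<otimes> g y) \<otimes> (h \<alpha> \<otimes> h \<beta>)"
      by (simp add: g_commute_pow m_assoc flip: x'_def)
    also have "g x' \<otimes> g y = g (x' \<otimes>\<^bsub>M\<^esub> y) \<otimes> lam x' y"
      by (simp add: g_mult centre_comm[OF lam_centre])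
    also have "?e [^] k \<otimes> ?e [^] m \<otimes> (g (x' \<otimes>\<^bsub>M\<^esub> y) \<otimes> lam x' y) \<otimes> (h \<alpha> \<otimes> h \<beta>) =
        ?e [^] (k + m) \<otimes> g (x' \<otimes>\<^bsub>M\<^esub> y) \<otimes> (lam x' y \<otimes> (h \<alpha> \<otimes> h \<beta>))"
      by (simp add: int_pow_mult lam_closed m_assoc)
    also have "lam x' y \<otimes> (h \<alpha> \<otimes> h \<beta>) = h \<alpha> \<otimes> h \<beta> \<otimes> lam x' y"
      by (rule centre_comm[OF lam_centre]) simp_all
    also have "\<dots> = h (\<alpha> \<otimes>\<^bsub>?S\<^esub> \<beta> \<otimes>\<^bsub>?S\<^esub> S_class M T x' y)"
      using s by (simp add: h_mult h_class S_class_closed[OF M T])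
    finally show "(case a \<otimes>\<^bsub>F_group M T\<^esub> b of (k, x, \<alpha>) \<Rightarrow> ?e [^] k \<otimes> g x \<otimes> h \<alpha>) =
        (case a of (k, x, \<alpha>) \<Rightarrow> ?e [^] k \<otimes> g x \<otimes> h \<alpha>) \<otimes>
        (case b of (k, x, \<alpha>) \<Rightarrow> ?e [^] k \<otimes> g x \<otimes> h \<alpha>)"
      unfolding ab mult_F_group x'_def[symmetric] by simp
  qed (auto simp: carrier_F_group hc)
  moreover have "h \<in> hom ?S G"
    by (rule homI) (simp_all add: hc h_mult)
  ultimately show ?thesis using that h_class by blast
qed

text \<open>A homomorphism to \<open>F(M, T)\<close> with the expected values on generators is a left inverse
  of the map of \<open>F_group_hom\<close>, whose image contains the generators.\<close>

lemma F_group_iso: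
  assumes p: "p \<in> hom G (F_group M T)"
    and p_e: "\<And>x. x \<in> carrier M \<Longrightarrow> p (e x) = (1, x, \<one>\<^bsub>S_group M T\<^esub>)"
  shows "F_group M T \<cong> G"
proof -
  note M = M.comm_group_axioms
  let ?S = "S_group M T" and ?F = "F_group M T" and ?e = "e \<one>\<^bsub>M\<^esub>"
  interpret S: comm_group ?S by (rule comm_group_S_group[OF M T])
  interpret F: group ?F by (rule group_F_group[OF M T])
  interpret p: group_hom G ?F p
    by (simp add: group_hom_def group_hom_axioms_def p F.is_group is_group)
  note [simp] = S_class_one[OF M T] S_class_closed[OF M T] auto_group_one[OF M.is_group T]
  have T_one: "(T [^]\<^bsub>AutoGroup M\<^esub> m) \<one>\<^bsub>M\<^esub> = \<one>\<^bsub>M\<^esub>" for m :: int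
    using auto_int_pow[OF M.is_group T, of m] by (simp add: auto_def hom_one M.is_group)
  obtain h where q: "(\<lambda>(k, x, \<alpha>). ?e [^] k \<otimes> g x \<otimes> h \<alpha>) \<in> hom ?F G" (is "?q \<in> _")
    and h: "h \<in> hom ?S G"
    and h_class: "\<And>x y. x \<in> carrier M \<Longrightarrow> y \<in> carrier M \<Longrightarrow> h (S_class M T x y) = lam x y"
    by (rule F_group_hom) blast
  interpret q: group_hom ?F G ?q
    by (simp add: group_hom_def group_hom_axioms_def q F.is_group is_group)
  interpret h: group_hom ?S G h
    by (simp add: group_hom_def group_hom_axioms_def h S.is_group is_group)
  have p_g: "p (g x) = (0, x, \<one>\<^bsub>?S\<^esub>)" if x: "x \<in> carrier M" for x
  proof -
    have "p ?e \<otimes>\<^bsub>?F\<^esub> p (g x) = p ?e \<otimes>\<^bsub>?F\<^esub> (0, x, \<one>\<^bsub>?S\<^esub>)"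
      using x p.hom_mult[of ?e "g x"] by (simp add: mult_F_group p_e e_one_g)
    moreover have "(0, x, \<one>\<^bsub>?S\<^esub>) \<in> carrier ?F" using x by (simp add: carrier_F_group)
    ultimately show ?thesis using x by (simp only: F.Units_l_cancel F.Units_eq p.hom_closed
        e_closed g_closed M.one_closed)
  qed
  \<comment> \<open>Apply \<open>p\<close> to \<open>g_mult\<close>: in F(M, T), (0, x, 0)(0, y, 0)
    is (0, x + y, [x \<otimes> y]).\<close>
  have p_lam: "p (lam x y) = (0, \<one>\<^bsub>M\<^esub>, S_class M T x y)"
    if x: "x \<in> carrier M" and y: "y \<in> carrier M" for x y
  proof -
    have "p (lam x y) \<otimes>\<^bsub>?F\<^esub> p (g (x \<otimes>\<^bsub>M\<^esub> y)) = p (g x) \<otimes>\<^bsub>?F\<^esub> p (g y)"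
      using x y lam_closed by (simp add: g_mult flip: p.hom_mult)
    also have "\<dots> = (0, \<one>\<^bsub>M\<^esub>, S_class M T x y) \<otimes>\<^bsub>?F\<^esub> p (g (x \<otimes>\<^bsub>M\<^esub> y))"
      using x y by (simp add: p_g mult_F_group)
    finally have "p (lam x y) \<otimes>\<^bsub>?F\<^esub> p (g (x \<otimes>\<^bsub>M\<^esub> y)) =
        (0, \<one>\<^bsub>M\<^esub>, S_class M T x y) \<otimes>\<^bsub>?F\<^esub> p (g (x \<otimes>\<^bsub>M\<^esub> y))" .
    moreover have "(0, \<one>\<^bsub>M\<^esub>, S_class M T x y) \<in> carrier ?F"
      using x y by (simp add: carrier_F_group)
    ultimately show ?thesis using x y by (simp only: F.right_cancel p.hom_closed lam_closed
        g_closed M.m_closed)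
  qed
  \<comment> \<open>k |-> (k, 0, 0) is a homomorphism from the integers, so these are the powers of
    (1, 0, 0).\<close>
  have p_pow: "p (?e [^] k) = (k, \<one>\<^bsub>M\<^esub>, \<one>\<^bsub>?S\<^esub>)" for k :: int
  proof -
    have "(\<lambda>k. (k, \<one>\<^bsub>M\<^esub>, \<one>\<^bsub>?S\<^esub>)) \<in> hom integer_group ?F"
      by (rule homI) (auto simp: carrier_F_group mult_F_group T_one)
    from hom_int_pow[OF this, of 1 k] show ?thesis
      by (simp add: p.hom_int_pow p_e F.is_group)
  qed
  \<comment> \<open>This inclusion and the composite of \<open>h\<close> with \<open>p\<close> agree
    on the classes [x \<otimes> y], hence everywhere.\<close>
  have "(\<lambda>\<alpha>. (0, \<one>\<^bsub>M\<^esub>, \<alpha>)) \<in> hom ?S ?F"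
    by (rule homI) (auto simp: carrier_F_group mult_F_group)
  then have p_h: "p (h \<alpha>) = (0, \<one>\<^bsub>M\<^esub>, \<alpha>)" if "\<alpha> \<in> carrier ?S" for \<alpha>
    using S_group_hom_eqI[OF M T F.is_group Group.hom_compose[OF h p] _ _ that] by (simp add: h_class p_lam)
  have pq: "p (?q a) = a" if a: "a \<in> carrier ?F" for a
  proof -
    obtain k x \<alpha> where a_eq: "a = (k, x, \<alpha>)" by (cases a)
    then have "x \<in> carrier M" "\<alpha> \<in> carrier ?S" using a by (auto simp: carrier_F_group)
    then show ?thesis by (simp add: a_eq p_pow p_g p_h mult_F_group T_one)
  qed
  \<comment> \<open>Surjectivity: the image of \<open>?q\<close> is a subgroup containing the
    generators. Injectivity is \<open>pq\<close>.\<close>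
  have "e ` carrier M \<subseteq> ?q ` carrier ?F"
  proof (rule image_subsetI)
    fix x assume x: "x \<in> carrier M"
    then have "e x = ?q (1, x, \<one>\<^bsub>?S\<^esub>)" by (simp add: e_one_g)
    moreover have "(1, x, \<one>\<^bsub>?S\<^esub>) \<in> carrier ?F" using x by (simp add: carrier_F_group)
    ultimately show "e x \<in> ?q ` carrier ?F" by (rule image_eqI)
  qed
  then have "carrier G \<subseteq> ?q ` carrier ?F"
    using generate_subgroup_incl[OF _ q.img_is_subgroup] generate_e by metis
  then have "bij_betw ?q (carrier ?F) (carrier G)"
    using pq hom_in_carrier[OF q] by (intro bij_betwI[where g = p]) (auto 0 3)
  with q show ?thesis unfolding is_iso_def iso_def by blast
qed

end

section \<open>The adjoint group as a representation, and the isomorphism\<close>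

theorem theorem1:
  fixes M :: "('a, 'b) monoid_scheme" and T :: "'a \<Rightarrow> 'a"
  assumes "comm_group M"
    and "T \<in> auto M"
    and "one_minus M T \<in> auto M"
  shows "adjoint_group (alexander_quandle M T) \<cong> F_group M T"
proof -
  interpret M: comm_group M by fact
  let ?S = "S_group M T" and ?F = "F_group M T"
  interpret S: comm_group ?S by (rule comm_group_S_group[OF assms(1,2)])
  interpret F: group ?F by (rule group_F_group[OF assms(1,2)])
  let ?A = "alexander_quandle M T"
  define R where "R = {([Gen (qop ?A y x)], [Gen_inv x, Gen y, Gen x]) | x y.
    x \<in> carrier ?A \<and> y \<in> carrier ?A}"
  let ?G = "presented_group (carrier M) R"
  define e where "e x = presentation_rel (carrier M) R `` {[Gen x]}" for x
  have adj: "adjoint_group ?A = ?G"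
    by (simp add: adjoint_group_def R_def) (simp add: alexander_quandle_def)
  have R_iff: "(u, v) \<in> R \<longleftrightarrow> (\<exists>x\<in>carrier M. \<exists>y\<in>carrier M.
      u = [Gen (T y \<otimes>\<^bsub>M\<^esub> one_minus M T x)] \<and> v = [Gen_inv x, Gen y, Gen x])" for u v
    using auto_carrier[OF assms(2)]
    by (auto simp: R_def alexander_quandle_def one_minus_def M.m_assoc)
  interpret G: group ?G by (rule group_presented_group)
  interpret alexander_representation ?G M T e
  proof
    fix x y assume x: "x \<in> carrier M" and y: "y \<in> carrier M"
    have q: "T y \<otimes>\<^bsub>M\<^esub> one_minus M T x \<in> carrier M"
      using auto_carrier[OF assms(2) y] auto_carrier[OF assms(3) x] by simp
    have w: "[Gen x] \<in> words (carrier M)" "[Gen_inv x] \<in> words (carrier M)"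
      "[Gen y] \<in> words (carrier M)" "[Gen (T y \<otimes>\<^bsub>M\<^esub> one_minus M T x)] \<in> words (carrier M)"
      using x y q by (auto simp: words_def)
    have cl: "e x \<in> carrier ?G" if "x \<in> carrier M" for x
      using that by (auto simp: e_def presented_group_def quotient_def words_def)
    then show "e x \<in> carrier ?G" using x .
    \<comment> \<open>The relator is split into single letters so that its class becomes a product
      in the group.\<close>
    have "([Gen (T y \<otimes>\<^bsub>M\<^esub> one_minus M T x)], [Gen_inv x] @ ([Gen y] @ [Gen x])) \<in>
        presentation_rel (carrier M) R"
      using x y w by (intro presentation_rel.relator) (auto simp: R_iff words_append[of "[_]"] words_def)
    then have "e (T y \<otimes>\<^bsub>M\<^esub> one_minus M T x) =
        presentation_rel (carrier M) R `` {[Gen_inv x] @ ([Gen y] @ [Gen x])}"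
      unfolding e_def by (rule equiv_class_eq[OF equiv_presentation_rel])
    also have "\<dots> = inv\<^bsub>?G\<^esub> e x \<otimes>\<^bsub>?G\<^esub> (e y \<otimes>\<^bsub>?G\<^esub> e x)"
      unfolding e_def presented_group_inv_generator[OF x, symmetric]
      using w by (simp add: mult_presented_group words_append[of "[_]" "[_]", simplified])
    finally show "e y \<otimes>\<^bsub>?G\<^esub> e x = e x \<otimes>\<^bsub>?G\<^esub> e (T y \<otimes>\<^bsub>M\<^esub> one_minus M T x)"
      using cl x y q by (subst (asm) G.inv_solve_left) auto
  qed (use assms presented_group_generated[of "carrier M" R] in \<open>simp_all add: e_def\<close>)
  define f where "f x = (1::int, x, \<one>\<^bsub>?S\<^esub>)" for x :: 'a
  have f: "f x \<in> carrier ?F" if "x \<in> carrier M" for x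
    using that by (simp add: f_def carrier_F_group)
  have f_commute: "f y \<otimes>\<^bsub>?F\<^esub> f x = f x \<otimes>\<^bsub>?F\<^esub> f (T y \<otimes>\<^bsub>M\<^esub> D x)"
    if x: "x \<in> carrier M" and y: "y \<in> carrier M" for x y
  proof -
    \<comment> \<open>The middle coordinates agree because Tx + Dx = x.\<close>
    have "T x \<otimes>\<^bsub>M\<^esub> (T y \<otimes>\<^bsub>M\<^esub> D x) = T y \<otimes>\<^bsub>M\<^esub> (T x \<otimes>\<^bsub>M\<^esub> D x)"
      using x y by (simp add: M.m_ac)
    also have Dx: "T x \<otimes>\<^bsub>M\<^esub> D x = x"
      using x by (simp add: one_minus_def M.m_ac)
    finally have 1: "T x \<otimes>\<^bsub>M\<^esub> (T y \<otimes>\<^bsub>M\<^esub> D x) = T y \<otimes>\<^bsub>M\<^esub> x" .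
    have swap: "S_class M T (T a) b = S_class M T b a" if "a \<in> carrier M" "b \<in> carrier M" for a b
      using S_class_swap[OF assms(1,2)] that by simp
    \<comment> \<open>The last coordinates require [Tx \<otimes> (Ty + Dx)] = [Ty \<otimes> x]. The
      swap rule gives [Tx \<otimes> Ty] = [Ty \<otimes> x], and [Tx \<otimes> Dx] vanishes since
      [Tx \<otimes> x] = [Tx \<otimes> Tx].\<close>
    have "S_class M T (T x) (T x) \<otimes>\<^bsub>?S\<^esub> S_class M T (T x) (D x) = S_class M T (T x) x"
      using x by (simp add: Dx flip: S_class_mult_right[OF assms(1,2)])
    also have "\<dots> = S_class M T (T x) (T x)"
      using x by (simp add: swap)
    finally have "S_class M T (T x) (D x) = \<one>\<^bsub>?S\<^esub>"
      using x by (simp add: S_class_closed[OF assms(1,2)])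
    then have "S_class M T (T x) (T y \<otimes>\<^bsub>M\<^esub> D x) = S_class M T (T y) x"
      using x y by (simp add: S_class_mult_right[OF assms(1,2)] S_class_closed[OF assms(1,2)] swap)
    with 1 show ?thesis
      unfolding f_def mult_F_group auto_int_pow_1[OF M.is_group assms(2)] by simp
  qed
  obtain p where p: "p \<in> hom ?G ?F" "\<And>x. x \<in> carrier M \<Longrightarrow> p (e x) = f x"
  proof (rule F.presented_group_universal[of f "carrier M" R])
    show "word_eval ?F f u = word_eval ?F f v" if uv: "(u, v) \<in> R" for u v
    proof -
      obtain x y where x: "x \<in> carrier M" and y: "y \<in> carrier M"
        and u: "u = [Gen (T y \<otimes>\<^bsub>M\<^esub> D x)]" and v: "v = [Gen_inv x, Gen y, Gen x]"
        using uv R_iff by blast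
      have "f (T y \<otimes>\<^bsub>M\<^esub> D x) \<in> carrier ?F" using x y by (intro f) simp
      then show ?thesis
        using f[OF x] f[OF y] by (simp add: u v F.inv_solve_left f_commute[OF x y])
    qed
  qed (use f that in \<open>auto simp: e_def\<close>)
  show ?thesis
    unfolding adj by (rule group.iso_sym[OF F.is_group F_group_iso[OF p[unfolded f_def]]])
qed

end
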